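(* Let $\theta:\mathbb{R}^m\to(-\infty,\infty]$ be convex piecewise linear, and let $\varphi_0:\mathbb{R}^n\times\mathbb{R}^d\to\mathbb{R}$ and $\Phi:\mathbb{R}^n\times\mathbb{R}^d\to\mathbb{R}^m$ be $\mathcal{C}^2$-smooth. Let $\bar w\in\mathbb{R}^d$, let $\bar x\in\mathbb{R}^n$ satisfy $\bar z:=\Phi(\bar x,\bar w)\in\operatorname{dom}\theta$, let $\bar v=0\in\nabla_x\varphi_0(\bar x,\bar w)+\nabla_x\Phi(\bar x,\bar w)^*\partial\theta(\bar z)$, and let $\bar\lambda\in\partial\theta(\bar z)$ satisfy $\nabla_x\varphi_0(\bar x,\bar w)+\nabla_x\Phi(\bar x,\bar w)^*\bar\lambda=0$. Assume that the first-order qualification condition $\partial^\infty\theta(\bar z)\cap\ker\nabla_x\Phi(\bar x,\bar w)^*=\{0\}$ holds. Then the following are equivalent: (i) $\bar x$ is a local minimizer of $\mathcal{P}(\bar w,0)$ that is strongly Lipschitz stable, and the nondegeneracy condition ND holds at $(\bar x,\bar w)$. (ii) $\bar x\in M_\gamma(\bar w,0)$ for some $\gamma>0$, and $(\bar x,\bar\lambda)$ is a strongly regular solution of the KKT system of $\mathcal{P}(\bar w,0)$.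
   Context: **Convex piecewise linear (CPWL).** $\theta$ is CPWL if $\operatorname{dom}\theta$ is a nonempty convex polyhedron and $\theta$ equals on $\operatorname{dom}\theta$ a maximum of finitely many affine functions (and $\infty$ outside). $\partial\theta$ is the subdifferential of convex analysis; $\partial^\infty\theta(\bar z)=\{v:(v,0)\in N((\bar z,\theta(\bar z));\operatorname{epi}\theta)\}=N(\bar z;\operatorname{dom}\theta)$ is the singular subdifferential. **Standing assumption.** $0\in\operatorname{aff}\partial\theta(\bar z)$. **Nondegeneracy condition ND** at $(\bar x,\bar w)$: $S(\bar z)\cap\ker\nabla_x\Phi(\bar x,\bar w)^*=\{0\}$ (equivalently $\nabla_x\Phi(\bar x,\bar w)\mathbb{R}^n+S(\bar z)^\perp=\mathbb{R}^m$), where $S(\bar z)$ is the linear subspace of $\mathbb{R}^m$ parallel to $\operatorname{aff}\partial\theta(\bar z)$. **Problem $\mathcal{P}(w,v)$**, $(w,v)\in\mathbb{R}^d\times\mathbb{R}^n$: minimize $\varphi_0(x,w)+\theta(\Phi(x,w))-\langle v,x\rangle$ over $x\in\mathbb{R}^n$. For $\gamma>0$, $M_\gamma(w,v):=\operatorname{argmin}_{\|x-\bar x\|\le\gamma}\{\varphi_0(x,w)+\theta(\Phi(x,w))-\langle v,x\rangle\}$ ($:=\emptyset$ if the expression is identically $\infty$). **Strong Lipschitzian stability.** For $q\in\mathbb{N}$ and $\bar u\in\mathbb{R}^q$, a pair of $\mathcal{C}^2$-smooth mappings $\xi:\mathbb{R}^n\times\mathbb{R}^q\to\mathbb{R}$,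 $\Upsilon:\mathbb{R}^n\times\mathbb{R}^q\to\mathbb{R}^m$ is a $\mathcal{C}^2$-smooth parametrization of $(\varphi_0(\cdot,\bar w),\Phi(\cdot,\bar w))$ at $\bar u$ if $\xi(x,\bar u)=\varphi_0(x,\bar w)$ and $\Upsilon(x,\bar u)=\Phi(x,\bar w)$ for all $x\in\mathbb{R}^n$. Let $\widehat{\mathcal{P}}(u)$ be the problem: minimize $\xi(x,u)+\theta(\Upsilon(x,u))$ over $x\in\mathbb{R}^n$; its stationary points are the $x$ with $0\in\nabla_x\xi(x,u)+\nabla_x\Upsilon(x,u)^*\partial\theta(\Upsilon(x,u))$. The stationary point $\bar x$ of $\mathcal{P}(\bar w,0)$ is strongly Lipschitz stable with respect to this parametrization if there are neighborhoods $U$ of $\bar u$ and $O$ of $\bar x$ such that for every $u\in U$ the problem $\widehat{\mathcal{P}}(u)$ has a unique stationary point $x(u)\in O$, and the mapping $u\mapsto x(u)$ is locally Lipschitzian around $\bar u$. It is strongly Lipschitz stable if this holds for every $\mathcal{C}^2$-smooth parametrization (every $q$, $\bar u\in\mathbb{R}^q$, $\xi$, $\Upsilon$). **KKT system and strong regularity.** Let $L(x,w,\lambda):=\varphi_0(x,w)+\langle\lambda,\Phi(x,w)\rangle$. The KKT system of $\mathcal{P}(w,v)$ is $v=\nabla_xL(x,w,\lambda)$, $0\in-\Phi(x,w)+(\partial\theta)^{-1}(\lambda)$. A solution $(\bar x,\bar\lambda)$ of this system for $(w,v)=(\bar w,0)$ is strongly regular if the solution map $(v_1,v_2)\mapsto\{(x,\lambda)\}$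 of the linearized system $$v_1=\nabla^2_{xx}L(\bar x,\bar w,\bar\lambda)(x-\bar x)+\nabla_x\Phi(\bar x,\bar w)^*(\lambda-\bar\lambda),\qquad v_2\in-\Phi(\bar x,\bar w)-\nabla_x\Phi(\bar x,\bar w)(x-\bar x)+(\partial\theta)^{-1}(\lambda)$$ admits a Lipschitzian single-valued graphical localization around $(0,0,\bar x,\bar\lambda)$, i.e. there are neighborhoods $U$ of $(0,0)\in\mathbb{R}^n\times\mathbb{R}^m$ and $V$ of $(\bar x,\bar\lambda)$ such that the graph of the solution map intersected with $U\times V$ is the graph of a Lipschitz continuous single-valued mapping from $U$ to $V$. *)

theory Defs
  imports "HOL-Analysis.Analysis"
begin

section \<open>Convex piecewise linear functions and their subdifferentials\<close>

definition edom :: "('a \<Rightarrow> ereal) \<Rightarrow> 'a set" where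
  "edom \<theta> = {z. \<theta> z < \<infinity>}"

text \<open>Since the maximum is real, a CPWL function never takes the value \<open>-\<infinity>\<close>.\<close>

definition cpwl :: "('a::euclidean_space \<Rightarrow> ereal) \<Rightarrow> bool" where
  "cpwl \<theta> \<longleftrightarrow> edom \<theta> \<noteq> {} \<and> polyhedron (edom \<theta>) \<and>
     (\<exists>A :: ('a \<times> real) set. finite A \<and> A \<noteq> {} \<and>
        (\<forall>z \<in> edom \<theta>. \<theta> z = ereal (Max ((\<lambda>(a, b). a \<bullet> z + b) ` A))))"

definition subdifferential :: "('a::real_inner \<Rightarrow> ereal) \<Rightarrow> 'a \<Rightarrow> 'a set" where
  "subdifferential \<theta> z =
     {v. \<bar>\<theta> z\<bar> \<noteq> \<infinity> \<and> (\<forall>y. \<theta> z + ereal (v \<bullet> (y - z)) \<le> \<theta> y)}"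

definition subdifferential_inv :: "('a::real_inner \<Rightarrow> ereal) \<Rightarrow> 'a \<Rightarrow> 'a set" where
  "subdifferential_inv \<theta> v = {z. v \<in> subdifferential \<theta> z}"

definition normal_cone :: "'a::real_inner \<Rightarrow> 'a set \<Rightarrow> 'a set" where
  "normal_cone z S = {v. z \<in> S \<and> (\<forall>y \<in> S. v \<bullet> (y - z) \<le> 0)}"

definition epi :: "('a \<Rightarrow> ereal) \<Rightarrow> ('a \<times> real) set" where
  "epi \<theta> = {(z, r). \<theta> z \<le> ereal r}"

definition singular_subdifferential :: "('a::real_inner \<Rightarrow> ereal) \<Rightarrow> 'a \<Rightarrow> 'a set" where
  "singular_subdifferential \<theta> z =
     {v. (v, 0) \<in> normal_cone (z, real_of_ereal (\<theta> z)) (epi \<theta>)}"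

definition parallel_subspace_of :: "'a::real_vector set \<Rightarrow> 'a set" where
  "parallel_subspace_of A = (THE L. subspace L \<and> affine_parallel A L)"

definition S_space :: "('a::euclidean_space \<Rightarrow> ereal) \<Rightarrow> 'a \<Rightarrow> 'a set" where
  "S_space \<theta> z = parallel_subspace_of (affine hull (subdifferential \<theta> z))"


section \<open>Smoothness\<close>

text \<open>
  \<open>C2_on S f\<close> is used for a linear subspace \<open>S\<close> only (either \<open>UNIV\<close> or
  \<open>UNIV \<times> Rspace q\<close> below); it then says that \<open>f\<close>, restricted to the vector space \<open>S\<close>,
  is twice continuously Frechet differentiable.  The values of \<open>f'\<close> and \<open>f''\<close> in directions
  outside \<open>S\<close> are unconstrained except for continuity; this is harmless, as for
  the subspaces used there is a bounded linear projection onto \<open>S\<close> with which derivatives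
  defined on \<open>S\<close> can be extended.
\<close>

definition C2_on :: "'a::real_normed_vector set \<Rightarrow> ('a \<Rightarrow> 'b::real_normed_vector) \<Rightarrow> bool" where
  "C2_on S f \<longleftrightarrow>
     (\<exists>(f' :: 'a \<Rightarrow> 'a \<Rightarrow>\<^sub>L 'b) (f'' :: 'a \<Rightarrow> 'a \<Rightarrow>\<^sub>L ('a \<Rightarrow>\<^sub>L 'b)).
        (\<forall>p \<in> S. (f has_derivative blinfun_apply (f' p)) (at p within S)) \<and>
        (\<forall>p \<in> S. (f' has_derivative blinfun_apply (f'' p)) (at p within S)) \<and>
        continuous_on S f'')"

definition gradient :: "('a::real_inner \<Rightarrow> real) \<Rightarrow> 'a \<Rightarrow> 'a" where
  "gradient f x = (THE g. GDERIV f x :> g)"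

abbreviation jacobian ::
  "('a::euclidean_space \<Rightarrow> 'b::euclidean_space) \<Rightarrow> 'a \<Rightarrow> 'a \<Rightarrow> 'b" where
  "jacobian F x \<equiv> frechet_derivative F (at x)"

abbreviation jacobian_adj ::
  "('a::euclidean_space \<Rightarrow> 'b::euclidean_space) \<Rightarrow> 'a \<Rightarrow> 'b \<Rightarrow> 'a" where
  "jacobian_adj F x \<equiv> adjoint (jacobian F x)"


section \<open>The optimization problem\<close>

definition objective ::
  "('x::euclidean_space \<times> 'w \<Rightarrow> real) \<Rightarrow> ('z \<Rightarrow> ereal) \<Rightarrow> ('x \<times> 'w \<Rightarrow> 'z) \<Rightarrow>
   'w \<Rightarrow> 'x \<Rightarrow> 'x \<Rightarrow> ereal" where
  "objective \<phi>0 \<theta> \<Phi> w v x = ereal (\<phi>0 (x, w)) + \<theta> (\<Phi> (x, w)) - ereal (v \<bullet> x)"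

text \<open>The condition \<open>f x < \<infinity>\<close> makes the set of minimizers empty exactly when \<open>f\<close> is
  identically \<open>\<infinity>\<close> on \<open>X\<close> or no minimum is attained.\<close>

definition argmin_on :: "'x set \<Rightarrow> ('x \<Rightarrow> ereal) \<Rightarrow> 'x set" where
  "argmin_on X f = {x \<in> X. f x < \<infinity> \<and> (\<forall>y \<in> X. f x \<le> f y)}"

definition local_minimizer :: "('x::topological_space \<Rightarrow> ereal) \<Rightarrow> 'x \<Rightarrow> bool" where
  "local_minimizer f x \<longleftrightarrow> (\<exists>N. open N \<and> x \<in> N \<and> x \<in> argmin_on N f)"

definition M_loc ::
  "('x::euclidean_space \<times> 'w \<Rightarrow> real) \<Rightarrow> ('z \<Rightarrow> ereal) \<Rightarrow> ('x \<times> 'w \<Rightarrow> 'z) \<Rightarrow>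
   'x \<Rightarrow> real \<Rightarrow> 'w \<Rightarrow> 'x \<Rightarrow> 'x set" where
  "M_loc \<phi>0 \<theta> \<Phi> xbar \<gamma> w v = argmin_on (cball xbar \<gamma>) (objective \<phi>0 \<theta> \<Phi> w v)"

definition stationary ::
  "('z::euclidean_space \<Rightarrow> ereal) \<Rightarrow> ('x::euclidean_space \<Rightarrow> real) \<Rightarrow> ('x \<Rightarrow> 'z) \<Rightarrow> 'x \<Rightarrow> bool" where
  "stationary \<theta> f F x \<longleftrightarrow>
     0 \<in> (\<lambda>\<mu>. gradient f x + jacobian_adj F x \<mu>) ` subdifferential \<theta> (F x)"

definition nondegenerate ::
  "('z::euclidean_space \<Rightarrow> ereal) \<Rightarrow> ('x::euclidean_space \<times> 'w \<Rightarrow> 'z) \<Rightarrow> 'x \<Rightarrow> 'w \<Rightarrow> bool" where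
  "nondegenerate \<theta> \<Phi> x w \<longleftrightarrow>
     S_space \<theta> (\<Phi> (x, w)) \<inter> {\<mu>. jacobian_adj (\<lambda>y. \<Phi> (y, w)) x \<mu> = 0} = {0}"


section \<open>Strong Lipschitzian stability\<close>

text \<open>
  The dimension \<open>q\<close> of the parameter space is quantified inside the definition of strong
  Lipschitzian stability, so \<open>q\<close> cannot be a type index.  The space of \<open>q\<close>-tuples is therefore
  modelled as the subspace of those bounded real sequences that vanish from
  index \<open>q\<close> on.  It carries the maximum norm; smoothness, neighborhoods and Lipschitz
  continuity do not depend on the choice of the norm in finite dimension.
\<close>

definition Rspace :: "nat \<Rightarrow> (nat \<Rightarrow>\<^sub>C real) set" where
  "Rspace q = {u. \<forall>i \<ge> q. apply_bcontfun u i = 0}"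

definition C2_parametrization ::
  "('x::euclidean_space \<times> 'w \<Rightarrow> real) \<Rightarrow> ('x \<times> 'w \<Rightarrow> 'z::euclidean_space) \<Rightarrow> 'w \<Rightarrow>
   nat \<Rightarrow> (nat \<Rightarrow>\<^sub>C real) \<Rightarrow>
   ('x \<times> (nat \<Rightarrow>\<^sub>C real) \<Rightarrow> real) \<Rightarrow> ('x \<times> (nat \<Rightarrow>\<^sub>C real) \<Rightarrow> 'z) \<Rightarrow> bool" where
  "C2_parametrization \<phi>0 \<Phi> wbar q ubar \<xi> \<Upsilon> \<longleftrightarrow>
     C2_on (UNIV \<times> Rspace q) \<xi> \<and> C2_on (UNIV \<times> Rspace q) \<Upsilon> \<and>
     (\<forall>x. \<xi> (x, ubar) = \<phi>0 (x, wbar)) \<and> (\<forall>x. \<Upsilon> (x, ubar) = \<Phi> (x, wbar))"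

definition strongly_Lipschitz_stable_wrt ::
  "('z::euclidean_space \<Rightarrow> ereal) \<Rightarrow> 'x::euclidean_space \<Rightarrow> nat \<Rightarrow> (nat \<Rightarrow>\<^sub>C real) \<Rightarrow>
   ('x \<times> (nat \<Rightarrow>\<^sub>C real) \<Rightarrow> real) \<Rightarrow> ('x \<times> (nat \<Rightarrow>\<^sub>C real) \<Rightarrow> 'z) \<Rightarrow> bool" where
  "strongly_Lipschitz_stable_wrt \<theta> xbar q ubar \<xi> \<Upsilon> \<longleftrightarrow>
     (\<exists>U N (X :: (nat \<Rightarrow>\<^sub>C real) \<Rightarrow> 'x).
        openin (top_of_set (Rspace q)) U \<and> ubar \<in> U \<and> open N \<and> xbar \<in> N \<and>
        (\<forall>u \<in> U. X u \<in> N \<and> stationary \<theta> (\<lambda>x. \<xi> (x, u)) (\<lambda>x. \<Upsilon> (x, u)) (X u) \<and>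
           (\<forall>y \<in> N. stationary \<theta> (\<lambda>x. \<xi> (x, u)) (\<lambda>x. \<Upsilon> (x, u)) y \<longrightarrow> y = X u)) \<and>
        (\<exists>U' K. openin (top_of_set (Rspace q)) U' \<and> ubar \<in> U' \<and> U' \<subseteq> U \<and>
           K-lipschitz_on U' X))"

definition strongly_Lipschitz_stable ::
  "('x::euclidean_space \<times> 'w \<Rightarrow> real) \<Rightarrow> ('z::euclidean_space \<Rightarrow> ereal) \<Rightarrow> ('x \<times> 'w \<Rightarrow> 'z) \<Rightarrow>
   'w \<Rightarrow> 'x \<Rightarrow> bool" where
  "strongly_Lipschitz_stable \<phi>0 \<theta> \<Phi> wbar xbar \<longleftrightarrow>
     stationary \<theta> (\<lambda>x. \<phi>0 (x, wbar)) (\<lambda>x. \<Phi> (x, wbar)) xbar \<and>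
     (\<forall>q. \<forall>ubar \<in> Rspace q. \<forall>\<xi> \<Upsilon>. C2_parametrization \<phi>0 \<Phi> wbar q ubar \<xi> \<Upsilon> \<longrightarrow>
        strongly_Lipschitz_stable_wrt \<theta> xbar q ubar \<xi> \<Upsilon>)"


section \<open>The KKT system and strong regularity\<close>

text \<open>The multiplier is called \<open>\<mu>\<close>, as the lambda symbol is reserved for abstraction.\<close>

definition lagrangian ::
  "('x \<times> 'w \<Rightarrow> real) \<Rightarrow> ('x \<times> 'w \<Rightarrow> 'z::real_inner) \<Rightarrow> 'x \<Rightarrow> 'w \<Rightarrow> 'z \<Rightarrow> real" where
  "lagrangian \<phi>0 \<Phi> x w \<mu> = \<phi>0 (x, w) + \<mu> \<bullet> \<Phi> (x, w)"

definition hessian_lagrangian ::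
  "('x::euclidean_space \<times> 'w \<Rightarrow> real) \<Rightarrow> ('x \<times> 'w \<Rightarrow> 'z::real_inner) \<Rightarrow>
   'x \<Rightarrow> 'w \<Rightarrow> 'z \<Rightarrow> 'x \<Rightarrow> 'x" where
  "hessian_lagrangian \<phi>0 \<Phi> x w \<mu> =
     frechet_derivative (gradient (\<lambda>y. lagrangian \<phi>0 \<Phi> y w \<mu>)) (at x)"

definition kkt_solution ::
  "('x::euclidean_space \<times> 'w \<Rightarrow> real) \<Rightarrow> ('z::euclidean_space \<Rightarrow> ereal) \<Rightarrow> ('x \<times> 'w \<Rightarrow> 'z) \<Rightarrow>
   'w \<Rightarrow> 'x \<Rightarrow> 'x \<Rightarrow> 'z \<Rightarrow> bool" where
  "kkt_solution \<phi>0 \<theta> \<Phi> w v x \<mu> \<longleftrightarrow>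
     v = gradient (\<lambda>y. lagrangian \<phi>0 \<Phi> y w \<mu>) x \<and>
     0 \<in> (\<lambda>z. - \<Phi> (x, w) + z) ` subdifferential_inv \<theta> \<mu>"

definition linearized_kkt_solutions ::
  "('x::euclidean_space \<times> 'w \<Rightarrow> real) \<Rightarrow> ('z::euclidean_space \<Rightarrow> ereal) \<Rightarrow> ('x \<times> 'w \<Rightarrow> 'z) \<Rightarrow>
   'w \<Rightarrow> 'x \<Rightarrow> 'z \<Rightarrow> 'x \<times> 'z \<Rightarrow> ('x \<times> 'z) set" where
  "linearized_kkt_solutions \<phi>0 \<theta> \<Phi> wbar xbar \<mu>bar = (\<lambda>(v1, v2). {(x, \<mu>).
     v1 = hessian_lagrangian \<phi>0 \<Phi> xbar wbar \<mu>bar (x - xbar)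
          + jacobian_adj (\<lambda>y. \<Phi> (y, wbar)) xbar (\<mu> - \<mu>bar) \<and>
     v2 \<in> (\<lambda>z. - \<Phi> (xbar, wbar) - jacobian (\<lambda>y. \<Phi> (y, wbar)) xbar (x - xbar) + z)
            ` subdifferential_inv \<theta> \<mu>})"

definition Lipschitz_localization ::
  "('p::metric_space \<Rightarrow> 'y::metric_space set) \<Rightarrow> 'p \<Rightarrow> 'y \<Rightarrow> bool" where
  "Lipschitz_localization F pbar ybar \<longleftrightarrow>
     (\<exists>U V s K. open U \<and> pbar \<in> U \<and> open V \<and> ybar \<in> V \<and>
        {(p, y). y \<in> F p} \<inter> U \<times> V = {(p, s p) | p. p \<in> U} \<and>
        K-lipschitz_on U s)"

definition strongly_regular_kkt_solution ::
  "('x::euclidean_space \<times> 'w \<Rightarrow> real) \<Rightarrow> ('z::euclidean_space \<Rightarrow> ereal) \<Rightarrow> ('x \<times> 'w \<Rightarrow> 'z) \<Rightarrow>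
   'w \<Rightarrow> 'x \<Rightarrow> 'z \<Rightarrow> bool" where
  "strongly_regular_kkt_solution \<phi>0 \<theta> \<Phi> wbar xbar \<mu>bar \<longleftrightarrow>
     kkt_solution \<phi>0 \<theta> \<Phi> wbar 0 xbar \<mu>bar \<and>
     Lipschitz_localization (linearized_kkt_solutions \<phi>0 \<theta> \<Phi> wbar xbar \<mu>bar)
       (0, 0) (xbar, \<mu>bar)"

end

theory Submission
  imports Defs
begin

text \<open>
  Being a local minimizer is the same requirement in (i) and (ii), so the content is: strong
  Lipschitzian stability together with ND amounts to strong regularity of the KKT system.

  Write the KKT system of a parametrized problem as the linearized system whose perturbation is the
  residual (linearized minus nonlinear part).  As the data are \<open>C\<^sup>2\<close>, near
  the reference point the residual is Lipschitz in the parameter and, with arbitrarily small constant,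
  in \<open>(x, \<mu>)\<close>.  By the contraction principle a Lipschitz localization of the solution map
  of one of the two systems then yields one for the other (Robinson).

  Since \<open>\<theta>\<close> is piecewise linear, \<open>\<partial>\<theta>(z) \<subseteq> \<partial>\<theta>(zbar)\<close> for
  \<open>z\<close> near \<open>zbar\<close>, so that differences of nearby multipliers lie in
  \<open>S(zbar)\<close>, where ND makes the adjoint Jacobian bounded below.  Hence the multiplier depends
  Lipschitz continuously on the stationary point, and it is automatically close to
  \<open>\<mu>bar\<close>; this translates between stationary points and KKT pairs.  For
  (i) \<open>\<Longrightarrow>\<close> (ii) the parametrization that tilts the objective by \<open>v1\<close> and shifts
  \<open>\<Phi>\<close> by \<open>v2\<close> suffices.
\<close>

section \<open>Perturbation of Lipschitz localizations\<close>

text \<open>With \<open>s\<close> the localization of \<open>F\<close>, solving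
  \<open>y \<in> F (r y u)\<close> near \<open>ybar\<close> means solving
  \<open>y = s (r y u)\<close>. The Lipschitz constant of \<open>r\<close> in \<open>y\<close> can
  be made as small as desired, so this map contracts a small ball, and its fixed point inherits
  Lipschitz dependence on \<open>u\<close>. The set \<open>P\<close> admits parameters from a
  subspace.\<close>

lemma Lipschitz_localization_perturbed:
  fixes F :: "'p::metric_space \<Rightarrow> 'y::euclidean_space set" and r :: "'y \<Rightarrow> 'u::metric_space \<Rightarrow> 'p"
  assumes loc: "Lipschitz_localization F pbar ybar" and ybar: "ybar \<in> F pbar"
    and u0: "ubar \<in> P" and r0: "r ybar ubar = pbar"
    and r: "\<And>\<epsilon>. \<epsilon> > 0 \<Longrightarrow> \<exists>\<delta>>0. \<forall>u \<in> P \<inter> ball ubar \<delta>. \<forall>u' \<in> P \<inter> ball ubar \<delta>.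
              \<forall>y \<in> ball ybar \<delta>. \<forall>y' \<in> ball ybar \<delta>.
              dist (r y u) (r y' u') \<le> \<epsilon> * dist y y' + L * dist u u'"
  obtains \<rho> \<delta> \<sigma> K where "\<rho> > 0" "\<delta> > 0"
    "\<And>u. u \<in> P \<inter> ball ubar \<delta> \<Longrightarrow> \<sigma> u \<in> ball ybar \<rho> \<and> \<sigma> u \<in> F (r (\<sigma> u) u)"
    "\<And>u y. u \<in> P \<inter> ball ubar \<delta> \<Longrightarrow> y \<in> ball ybar \<rho> \<Longrightarrow> y \<in> F (r y u) \<Longrightarrow> y = \<sigma> u"
    "K-lipschitz_on (P \<inter> ball ubar \<delta>) \<sigma>"
proof -
  obtain U V s K0 where U: "open U" "pbar \<in> U" and V: "open V" "ybar \<in> V"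
    and graph: "{(p, y). y \<in> F p} \<inter> U \<times> V = {(p, s p) | p. p \<in> U}" and s0: "K0-lipschitz_on U s"
    using loc unfolding Lipschitz_localization_def by blast
  \<comment> \<open>Enlarged by 1 to allow division by \<open>K\<close>; the same device gives
    \<open>L'\<close> below.\<close>
  define K where "K = K0 + 1"
  have K0: "K0 \<ge> 0" using s0 lipschitz_on_nonneg by blast
  then have K: "K > 0" by (simp add: K_def)
  have s: "K-lipschitz_on U s" by (rule lipschitz_on_le[OF s0]) (simp add: K_def)
  have iff: "y \<in> F p \<longleftrightarrow> y = s p" if "p \<in> U" "y \<in> V" for p y
    using graph that by (auto simp: set_eq_iff) 
  have ys: "s pbar = ybar" using iff U V ybar by simp
  define L' where "L' = \<bar>L\<bar> + 1"
  have L': "L' > 0" by (simp add: L'_def)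
  obtain \<delta>1 where \<delta>1: "\<delta>1 > 0" and est: "\<And>u u' y y'. u \<in> P \<inter> ball ubar \<delta>1 \<Longrightarrow> u' \<in> P \<inter> ball ubar \<delta>1 \<Longrightarrow>
      y \<in> ball ybar \<delta>1 \<Longrightarrow> y' \<in> ball ybar \<delta>1 \<Longrightarrow> dist (r y u) (r y' u') \<le> 1 / (2 * K) * dist y y' + L * dist u u'"
    using r[of "1 / (2 * K)"] K by (auto simp del: times_divide_eq_left)
  have est': "dist (r y u) (r y' u') \<le> 1 / (2 * K) * dist y y' + L' * dist u u'"
    if "u \<in> P \<inter> ball ubar \<delta>1" "u' \<in> P \<inter> ball ubar \<delta>1" "y \<in> ball ybar \<delta>1" "y' \<in> ball ybar \<delta>1" for u u' y y'
  proof -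
    have "L * dist u u' \<le> L' * dist u u'" by (intro mult_right_mono) (auto simp: L'_def)
    then show ?thesis using est[OF that] by linarith
  qed
  obtain \<delta>U where \<delta>U: "\<delta>U > 0" "ball pbar \<delta>U \<subseteq> U" using U open_contains_ball by blast
  obtain \<delta>V where \<delta>V: "\<delta>V > 0" "cball ybar \<delta>V \<subseteq> V" using V open_contains_cball by blast
  \<comment> \<open>The three bounds keep the closed ball where \<open>est'\<close> holds, inside
    \<open>V\<close>, and small enough that \<open>\<rho> / K \<le> \<delta>U\<close>, which keeps
    \<open>r y u\<close> in \<open>U\<close>.\<close>
  define \<rho> where "\<rho> = min (min (\<delta>1/2) \<delta>V) (K * \<delta>U / 2)"
  have \<rho>: "\<rho> > 0" "\<rho> < \<delta>1" "\<rho> \<le> \<delta>V" "\<rho> \<le> K * \<delta>U / 2" using \<delta>1 \<delta>V \<delta>U K by (auto simp: \<rho>_def)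
  \<comment> \<open>The changes of \<open>y\<close> and of \<open>u\<close> then each move
    \<open>r y u\<close> away from \<open>pbar\<close> by at most
    \<open>\<rho> / (2 * K)\<close>.\<close>
  define \<delta> where "\<delta> = min \<delta>1 (\<rho> / (2 * K * L'))"
  have \<delta>: "\<delta> > 0" "\<delta> \<le> \<delta>1" "\<delta> \<le> \<rho> / (2 * K * L')" using \<delta>1 \<rho> K L' by (auto simp: \<delta>_def)
  define D where "D = P \<inter> ball ubar \<delta>"
  have D1: "u \<in> P \<inter> ball ubar \<delta>1" if "u \<in> D" for u using that \<delta> by (auto simp: D_def)
  have B1: "y \<in> ball ybar \<delta>1" if "y \<in> cball ybar \<rho>" for y using that \<rho> by auto
  have rbd: "dist pbar (r y u) < \<rho> / K" if "u \<in> D" "y \<in> cball ybar \<rho>" for u y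
  proof -
    have "dist (r ybar ubar) (r y u) \<le> 1 / (2 * K) * dist ybar y + L' * dist ubar u"
      using u0 \<delta>1 by (intro est') (use that D1 B1 in auto)
    also have "\<dots> < 1 / (2 * K) * \<rho> + L' * (\<rho> / (2 * K * L'))"
      using that K L' \<delta> by (intro add_le_less_mono mult_left_mono mult_strict_left_mono) (auto simp: D_def)
    also have "\<dots> = \<rho> / K" using K L' by (simp add: field_simps)
    finally show ?thesis by (simp add: r0)
  qed
  have rU: "r y u \<in> U" if "u \<in> D" "y \<in> cball ybar \<rho>" for u y
  proof -
    have "\<rho> / K \<le> \<delta>U" using \<rho> K \<delta>U by (simp add: field_simps)
    then show ?thesis using rbd[OF that] \<delta>U by auto
  qed
  have inball: "s (r y u) \<in> ball ybar \<rho>" if "u \<in> D" "y \<in> cball ybar \<rho>" for u y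
  proof -
    have "dist (s pbar) (s (r y u)) \<le> K * dist pbar (r y u)"
      using lipschitz_onD[OF s] U rU that by blast
    also have "\<dots> < K * (\<rho> / K)" using rbd[OF that] K by (intro mult_strict_left_mono)
    finally show ?thesis using K by (simp add: ys)
  qed
  have contr: "dist (s (r y u)) (s (r y' u')) \<le> 1/2 * dist y y' + K * L' * dist u u'"
    if "u \<in> D" "u' \<in> D" "y \<in> cball ybar \<rho>" "y' \<in> cball ybar \<rho>" for u u' y y'
  proof -
    have "dist (s (r y u)) (s (r y' u')) \<le> K * dist (r y u) (r y' u')"
      using lipschitz_onD[OF s] rU that by blast
    also have "\<dots> \<le> K * (1 / (2 * K) * dist y y' + L' * dist u u')"
      using K that D1 B1 by (intro mult_left_mono est') auto
    also have "\<dots> = 1/2 * dist y y' + K * L' * dist u u'" using K by (simp add: field_simps)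
    finally show ?thesis .
  qed
  \<comment> \<open>The closed ball supplies completeness; by \<open>inball\<close> the fixed point
    lies in the open ball.\<close>
  have "\<exists>!y. y \<in> cball ybar \<rho> \<and> s (r y u) = y" if "u \<in> D" for u
  proof (rule Banach_fix[of _ "1/2"])
    show "complete (cball ybar \<rho>)" by (simp add: complete_eq_closed)
    show "cball ybar \<rho> \<noteq> {}" using \<rho> by auto
    show "(\<lambda>y. s (r y u)) ` cball ybar \<rho> \<subseteq> cball ybar \<rho>" using inball[OF that] ball_subset_cball by blast
    show "dist (s (r y u)) (s (r y' u)) \<le> 1/2 * dist y y'" if "y \<in> cball ybar \<rho>" "y' \<in> cball ybar \<rho>" for y y'
      using contr[OF \<open>u \<in> D\<close> \<open>u \<in> D\<close> that] by simp
  qed auto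
  then obtain \<sigma> where \<sigma>: "\<And>u. u \<in> D \<Longrightarrow> \<sigma> u \<in> cball ybar \<rho> \<and> s (r (\<sigma> u) u) = \<sigma> u"
    and \<sigma>u: "\<And>u y. u \<in> D \<Longrightarrow> y \<in> cball ybar \<rho> \<Longrightarrow> s (r y u) = y \<Longrightarrow> y = \<sigma> u"
    by metis
  have cV: "y \<in> V" if "y \<in> cball ybar \<rho>" for y using that \<rho> \<delta>V by auto
  have iff': "y \<in> F (r y u) \<longleftrightarrow> s (r y u) = y" if "u \<in> D" "y \<in> cball ybar \<rho>" for u y
    using iff[OF rU[OF that] cV[OF that(2)]] by auto
  show thesis
  proof (rule that)
    show "\<rho> > 0" "\<delta> > 0" by fact+
    show "\<sigma> u \<in> ball ybar \<rho> \<and> \<sigma> u \<in> F (r (\<sigma> u) u)" if "u \<in> P \<inter> ball ubar \<delta>" for u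
      using \<sigma>[of u] inball[of u "\<sigma> u"] iff'[of u "\<sigma> u"] that by (auto simp: D_def)
    show "y = \<sigma> u" if "u \<in> P \<inter> ball ubar \<delta>" "y \<in> ball ybar \<rho>" "y \<in> F (r y u)" for u y
    proof -
      have "u \<in> D" "y \<in> cball ybar \<rho>" using that by (auto simp: D_def)
      then show ?thesis using \<sigma>u iff' that by blast
    qed
    \<comment> \<open>The factor 2 arises from absorbing the contraction term, half of the distance
      of the two fixed points.\<close>
    show "(2 * K * L')-lipschitz_on (P \<inter> ball ubar \<delta>) \<sigma>"
    proof (rule lipschitz_onI)
      fix u u' assume "u \<in> P \<inter> ball ubar \<delta>" "u' \<in> P \<inter> ball ubar \<delta>"
      then have "u \<in> D" "u' \<in> D" by (auto simp: D_def)
      then show "dist (\<sigma> u) (\<sigma> u') \<le> 2 * K * L' * dist u u'"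
        using contr[of u u' "\<sigma> u" "\<sigma> u'"] \<sigma>[of u] \<sigma>[of u'] by simp
    qed (use K L' in simp)
  qed
qed

section \<open>Strict differentiability and partial adjoints\<close>

text \<open>The mean value inequality is applied on the convex set
  \<open>S \<inter> ball p \<delta>\<close>, where continuity of \<open>k'\<close> keeps it within
  \<open>\<epsilon>\<close> of \<open>k' p\<close>. Comparing two arbitrary points near
  \<open>p\<close>, and not only a point with \<open>p\<close>, is what a Lipschitz estimate of the
  residual requires.\<close>

lemma strict_derivative_on_convex:
  fixes k :: "'a::real_normed_vector \<Rightarrow> 'b::real_normed_vector" and k' :: "'a \<Rightarrow> 'a \<Rightarrow>\<^sub>L 'b"
  assumes S: "convex S" "p \<in> S" and der: "\<And>a. a \<in> S \<Longrightarrow> (k has_derivative k' a) (at a within S)"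
    and cont: "continuous_on S k'" and \<epsilon>: "\<epsilon> > 0"
  obtains \<delta> where "\<delta> > 0" "\<And>a b. a \<in> S \<inter> ball p \<delta> \<Longrightarrow> b \<in> S \<inter> ball p \<delta> \<Longrightarrow>
     norm (k a - k b - k' p (a - b)) \<le> \<epsilon> * norm (a - b)"
proof -
  obtain \<delta> where \<delta>: "\<delta> > 0" "\<And>a. a \<in> S \<Longrightarrow> dist a p < \<delta> \<Longrightarrow> dist (k' a) (k' p) < \<epsilon>"
    using cont S \<epsilon> unfolding continuous_on_iff by metis
  have C: "convex (S \<inter> ball p \<delta>)" using S by (intro convex_Int convex_ball)
  show thesis
  proof (rule that[OF \<delta>(1)])
    fix a b assume a: "a \<in> S \<inter> ball p \<delta>" and b: "b \<in> S \<inter> ball p \<delta>"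
    have "norm (k a - k b - k' p (a - b)) \<le> norm (a - b) * \<epsilon>"
    proof (rule differentiable_bound_linearization[where S = "S \<inter> ball p \<delta>" and f' = "\<lambda>a. blinfun_apply (k' a)"])
      show "b + t *\<^sub>R (a - b) \<in> S \<inter> ball p \<delta>" if "t \<in> {0..1}" for t
        using convexD_alt[OF C b a, of t] that by (simp add: algebra_simps)
      show "(k has_derivative blinfun_apply (k' x)) (at x within S \<inter> ball p \<delta>)" if "x \<in> S \<inter> ball p \<delta>" for x
        using that der by (blast intro: has_derivative_subset)
      show "onorm (blinfun_apply (k' x) - blinfun_apply (k' p)) \<le> \<epsilon>" if "x \<in> S \<inter> ball p \<delta>" for x
      proof -
        have "onorm (blinfun_apply (k' x) - blinfun_apply (k' p)) = norm (k' x - k' p)"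
          by (simp add: norm_blinfun.rep_eq minus_blinfun.rep_eq fun_diff_def)
        then show ?thesis using \<delta>(2)[of x] that by (simp add: dist_norm norm_minus_commute)
      qed
      show "p \<in> S \<inter> ball p \<delta>" using S \<delta> by simp
    qed
    then show "norm (k a - k b - k' p (a - b)) \<le> \<epsilon> * norm (a - b)" by (simp add: mult.commute)
  qed
qed

text \<open>The adjoint of the partial derivative in the first variable; for real-valued maps,
  \<open>adjx l 1\<close> is the partial gradient.\<close>

definition adjx :: "(('x::euclidean_space \<times> 'u::real_normed_vector) \<Rightarrow>\<^sub>L 'z::euclidean_space) \<Rightarrow> 'z \<Rightarrow> 'x" where
  "adjx l \<mu> = (\<Sum>b\<in>Basis. (\<mu> \<bullet> l (b, 0)) *\<^sub>R b)"

lemma inner_adjx: "adjx l \<mu> \<bullet> d = \<mu> \<bullet> l (d, 0)"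
proof -
  have "(d, 0) = (\<Sum>b\<in>Basis. (d \<bullet> b) *\<^sub>R (b, 0::'b))"
    by (rule prod_eqI) (simp_all add: fst_sum snd_sum euclidean_representation)
  then have "l (d, 0) = (\<Sum>b\<in>Basis. (d \<bullet> b) *\<^sub>R l (b, 0))"
    by (simp only: blinfun.sum_right blinfun.scaleR_right)
  then show ?thesis
    by (simp add: adjx_def inner_sum_left inner_sum_right mult.commute inner_commute)
qed

text \<open>Testing \<open>inner_adjx\<close> with the direction \<open>adjx l \<mu>\<close> itself
  and applying Cauchy-Schwarz leaves one factor to cancel.\<close>

lemma norm_adjx_le: "norm (adjx l \<mu>) \<le> norm l * norm \<mu>"
proof -
  have "norm (adjx l \<mu>) * norm (adjx l \<mu>) = \<mu> \<bullet> l (adjx l \<mu>, 0)"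
    by (simp add: inner_adjx power2_norm_eq_inner flip: power2_eq_square)
  also have "\<dots> \<le> norm \<mu> * norm (l (adjx l \<mu>, 0))" by (rule norm_cauchy_schwarz)
  also have "\<dots> \<le> norm \<mu> * (norm l * norm (adjx l \<mu>))"
    using norm_blinfun[of l "(adjx l \<mu>, 0)"] by (intro mult_left_mono) (auto simp: norm_Pair)
  finally have "norm (adjx l \<mu>) * norm (adjx l \<mu>) \<le> norm l * norm \<mu> * norm (adjx l \<mu>)"
    by (simp add: mult_ac)
  then show ?thesis by (cases "adjx l \<mu> = 0") auto
qed

lemma bounded_bilinear_adjx: "bounded_bilinear adjx"
proof (rule bounded_bilinear.intro)
  show "\<exists>K. \<forall>(l :: ('a \<times> 'b) \<Rightarrow>\<^sub>L 'c) \<mu>. norm (adjx l \<mu>) \<le> norm l * norm \<mu> * K"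
    by (rule exI[of _ 1]) (simp add: norm_adjx_le)
qed (auto simp: adjx_def inner_add_left inner_add_right blinfun.add_left blinfun.scaleR_left
       scaleR_left_distrib sum.distrib scaleR_sum_right)

interpretation adjx: bounded_bilinear adjx
  by (rule bounded_bilinear_adjx)

section \<open>The residual of the linearization\<close>

text \<open>Parameters range over a convex set \<open>P\<close> because \<open>Rspace q\<close> is a
  subspace and not a type. The derivatives are parameters of the locale since \<open>C2_on\<close>
  asserts only their existence.\<close>

locale C2_problem =
  fixes \<xi> :: "'x::euclidean_space \<times> 'u::real_normed_vector \<Rightarrow> real"
    and \<Upsilon> :: "'x \<times> 'u \<Rightarrow> 'z::euclidean_space"
    and P :: "'u set" and \<xi>' \<xi>'' \<Upsilon>' \<Upsilon>'' and xbar :: 'x and ubar :: 'u and \<mu>bar :: 'z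
  assumes convex_P: "convex P" and ubar: "ubar \<in> P"
    and \<xi>': "\<And>p. p \<in> UNIV \<times> P \<Longrightarrow> (\<xi> has_derivative blinfun_apply (\<xi>' p)) (at p within UNIV \<times> P)"
    and \<xi>'': "\<And>p. p \<in> UNIV \<times> P \<Longrightarrow> (\<xi>' has_derivative blinfun_apply (\<xi>'' p)) (at p within UNIV \<times> P)"
    and cont_\<xi>'': "continuous_on (UNIV \<times> P) \<xi>''"
    and \<Upsilon>': "\<And>p. p \<in> UNIV \<times> P \<Longrightarrow> (\<Upsilon> has_derivative blinfun_apply (\<Upsilon>' p)) (at p within UNIV \<times> P)"
    and \<Upsilon>'': "\<And>p. p \<in> UNIV \<times> P \<Longrightarrow> (\<Upsilon>' has_derivative blinfun_apply (\<Upsilon>'' p)) (at p within UNIV \<times> P)"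
    and cont_\<Upsilon>'': "continuous_on (UNIV \<times> P) \<Upsilon>''"
begin

text \<open>The Hessian in \<open>x\<close> of the Lagrangian at the reference point;
  \<open>frechet_derivative_gradient_lagrangian\<close> identifies it with the derivative of the
  gradient.\<close>

definition hess :: "'x \<Rightarrow> 'x" where
  "hess d = adjx (\<xi>'' (xbar, ubar) (d, 0)) 1 + adjx (\<Upsilon>'' (xbar, ubar) (d, 0)) \<mu>bar"

text \<open>The right-hand side \<open>(v1, v2)\<close> for which a pair satisfying the KKT equations at
  parameter \<open>u\<close> solves the linearized system.\<close>

definition residual :: "'x \<times> 'z \<Rightarrow> 'u \<Rightarrow> 'x \<times> 'z" where
  "residual y u = (hess (fst y - xbar) + adjx (\<Upsilon>' (xbar, ubar)) (snd y - \<mu>bar)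
       - adjx (\<xi>' (fst y, u)) 1 - adjx (\<Upsilon>' (fst y, u)) (snd y),
     \<Upsilon> (fst y, u) - \<Upsilon> (xbar, ubar) - \<Upsilon>' (xbar, ubar) (fst y - xbar, 0))"

text \<open>The multiplier is frozen at \<open>\<mu>bar\<close>, so that this is a function of
  \<open>p\<close> alone with a strict derivative; variation of the multiplier is treated separately
  as a bilinear term.\<close>

definition grad_lagr :: "'x \<times> 'u \<Rightarrow> 'x" where
  "grad_lagr p = adjx (\<xi>' p) 1 + adjx (\<Upsilon>' p) \<mu>bar"

lemma convex_UNIV_P: "convex ((UNIV :: 'x set) \<times> P)"
  using convex_P by (intro convex_Times) auto

lemma bar_in: "(xbar, ubar) \<in> UNIV \<times> P"
  using ubar by simp

text \<open>\<open>T1\<close> and \<open>T2\<close> turn the partial adjoints at fixed multiplier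
  into bounded operators, so the derivative depends continuously on \<open>p\<close> in operator
  norm.\<close>

lemma grad_lagr_deriv:
  obtains h' where "\<And>p. p \<in> UNIV \<times> P \<Longrightarrow> (grad_lagr has_derivative blinfun_apply (h' p)) (at p within UNIV \<times> P)"
    "continuous_on (UNIV \<times> P) h'" "\<And>d. hess d = h' (xbar, ubar) (d, 0)"
proof -
  define T1 :: "(('x \<times> 'u) \<Rightarrow>\<^sub>L real) \<Rightarrow>\<^sub>L 'x" where "T1 = Blinfun (\<lambda>l. adjx l 1)"
  define T2 :: "(('x \<times> 'u) \<Rightarrow>\<^sub>L 'z) \<Rightarrow>\<^sub>L 'x" where "T2 = Blinfun (\<lambda>l. adjx l \<mu>bar)"
  have T1: "T1 l = adjx l 1" for l
    by (simp add: T1_def bounded_linear_Blinfun_apply adjx.bounded_linear_left)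
  have T2: "T2 l = adjx l \<mu>bar" for l
    by (simp add: T2_def bounded_linear_Blinfun_apply adjx.bounded_linear_left)
  show thesis
  proof (rule that[of "\<lambda>p. (T1 o\<^sub>L \<xi>'' p) + (T2 o\<^sub>L \<Upsilon>'' p)"])
    fix p :: "'x \<times> 'u" assume p: "p \<in> UNIV \<times> P"
    show "(grad_lagr has_derivative blinfun_apply ((T1 o\<^sub>L \<xi>'' p) + (T2 o\<^sub>L \<Upsilon>'' p))) (at p within UNIV \<times> P)"
      unfolding grad_lagr_def[abs_def]
      by (rule has_derivative_eq_rhs, rule has_derivative_add,
          rule bounded_linear.has_derivative[OF adjx.bounded_linear_left \<xi>''[OF p]],
          rule bounded_linear.has_derivative[OF adjx.bounded_linear_left \<Upsilon>''[OF p]])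
         (simp add: fun_eq_iff blinfun.add_left T1 T2)
  next
    show "continuous_on (UNIV \<times> P) (\<lambda>p. (T1 o\<^sub>L \<xi>'' p) + (T2 o\<^sub>L \<Upsilon>'' p))"
      by (intro continuous_intros cont_\<xi>'' cont_\<Upsilon>'')
  qed (simp add: hess_def blinfun.add_left T1 T2)
qed

text \<open>The residual consists of strict linearization errors of \<open>grad_lagr\<close> and
  \<open>\<Upsilon>\<close> and of the product of
  \<open>\<Upsilon>' (xbar, ubar) - \<Upsilon>' (x, u)\<close> with \<open>\<mu> - \<mu>bar\<close>,
  both factors of which vanish at the reference point. Only the derivative in \<open>u\<close>,
  which is not subtracted, leaves a constant that does not shrink; hence \<open>L\<close> is chosen
  before \<open>\<epsilon>\<close>.\<close>

lemma residual_estimate: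
  obtains L where "\<And>\<epsilon>. \<epsilon> > 0 \<Longrightarrow> \<exists>\<delta>>0. \<forall>u \<in> P \<inter> ball ubar \<delta>. \<forall>u' \<in> P \<inter> ball ubar \<delta>.
              \<forall>y \<in> ball (xbar, \<mu>bar) \<delta>. \<forall>y' \<in> ball (xbar, \<mu>bar) \<delta>.
              dist (residual y u) (residual y' u') \<le> \<epsilon> * dist y y' + L * dist u u'"
proof -
  let ?p = "(xbar, ubar)"
  obtain h' where h': "\<And>p. p \<in> UNIV \<times> P \<Longrightarrow> (grad_lagr has_derivative blinfun_apply (h' p)) (at p within UNIV \<times> P)"
    and cont_h': "continuous_on (UNIV \<times> P) h'" and hess: "\<And>d. hess d = h' ?p (d, 0)"
    using grad_lagr_deriv by blast
  have cont_\<Upsilon>': "continuous_on (UNIV \<times> P) \<Upsilon>'"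
    using \<Upsilon>'' has_derivative_continuous continuous_on_eq_continuous_within by blast
  \<comment> \<open>One bound for all derivatives at the reference point; the added 1 also makes it
    a local Lipschitz constant of \<open>\<Upsilon>'\<close>.\<close>
  define M where "M = norm (h' ?p) + norm (\<Upsilon>' ?p) + norm (\<Upsilon>'' ?p) + 1"
  have M: "M > 0" "norm (h' ?p) \<le> M" "norm (\<Upsilon>' ?p) \<le> M" "norm (\<Upsilon>'' ?p) + 1 \<le> M"
    by (auto simp: M_def add_pos_nonneg intro: add_nonneg_pos)
  show thesis
  \<comment> \<open>The estimates \<open>e1\<close> and \<open>e2\<close> contribute
    \<open>M * W\<close> each, and \<open>\<epsilon> * W\<close> occurs three times with
    \<open>\<epsilon> \<le> 1\<close>.\<close>
  proof (rule that[of "2 * M + 3"])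
    fix \<epsilon>0 :: real assume \<epsilon>0: "\<epsilon>0 > 0"
    \<comment> \<open>The final sum contains \<open>\<epsilon> * X\<close> three times and
      \<open>\<epsilon> * N\<close> once, both \<open>X\<close> and \<open>N\<close> being at most
      \<open>dist y y'\<close>.\<close>
    define \<epsilon> where "\<epsilon> = min 1 (\<epsilon>0 / 4)"
    have \<epsilon>: "\<epsilon> > 0" "\<epsilon> \<le> 1" "4 * \<epsilon> \<le> \<epsilon>0" using \<epsilon>0 by (auto simp: \<epsilon>_def)
    obtain \<delta>1 where \<delta>1: "\<delta>1 > 0" "\<And>a b. a \<in> (UNIV \<times> P) \<inter> ball ?p \<delta>1 \<Longrightarrow> b \<in> (UNIV \<times> P) \<inter> ball ?p \<delta>1 \<Longrightarrow>
        norm (grad_lagr a - grad_lagr b - h' ?p (a - b)) \<le> \<epsilon> * norm (a - b)"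
      using strict_derivative_on_convex[OF convex_UNIV_P bar_in h' cont_h' \<epsilon>(1)] by blast
    obtain \<delta>2 where \<delta>2: "\<delta>2 > 0" "\<And>a b. a \<in> (UNIV \<times> P) \<inter> ball ?p \<delta>2 \<Longrightarrow> b \<in> (UNIV \<times> P) \<inter> ball ?p \<delta>2 \<Longrightarrow>
        norm (\<Upsilon> a - \<Upsilon> b - \<Upsilon>' ?p (a - b)) \<le> \<epsilon> * norm (a - b)"
      using strict_derivative_on_convex[OF convex_UNIV_P bar_in \<Upsilon>' cont_\<Upsilon>' \<epsilon>(1)] by blast
    obtain \<delta>3 where \<delta>3: "\<delta>3 > 0" "\<And>a b. a \<in> (UNIV \<times> P) \<inter> ball ?p \<delta>3 \<Longrightarrow> b \<in> (UNIV \<times> P) \<inter> ball ?p \<delta>3 \<Longrightarrow>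
        norm (\<Upsilon>' a - \<Upsilon>' b - \<Upsilon>'' ?p (a - b)) \<le> 1 * norm (a - b)"
      using strict_derivative_on_convex[OF convex_UNIV_P bar_in \<Upsilon>'' cont_\<Upsilon>'' zero_less_one] by blast
    have \<Upsilon>'_lip: "norm (\<Upsilon>' a - \<Upsilon>' b) \<le> M * norm (a - b)"
      if "a \<in> (UNIV \<times> P) \<inter> ball ?p \<delta>3" "b \<in> (UNIV \<times> P) \<inter> ball ?p \<delta>3" for a b
    proof -
      have "norm (\<Upsilon>' a - \<Upsilon>' b) \<le> norm (\<Upsilon>' a - \<Upsilon>' b - \<Upsilon>'' ?p (a - b)) + norm (\<Upsilon>'' ?p (a - b))"
        using norm_triangle_ineq[of "\<Upsilon>' a - \<Upsilon>' b - \<Upsilon>'' ?p (a - b)" "\<Upsilon>'' ?p (a - b)"] by simp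
      also have "\<dots> \<le> 1 * norm (a - b) + norm (\<Upsilon>'' ?p) * norm (a - b)"
        using \<delta>3(2)[OF that] by (intro add_mono norm_blinfun)
      also have "\<dots> \<le> M * norm (a - b)"
        using mult_right_mono[OF M(4), of "norm (a - b)"] by (simp add: algebra_simps)
      finally show ?thesis .
    qed
    \<comment> \<open>Halved because \<open>(x, u)\<close> is only within
      \<open>2 * \<delta>\<close> of the reference point; \<open>\<epsilon> / M\<close> makes both
      factors of the bilinear term in \<open>e3\<close> small.\<close>
    define \<delta> where "\<delta> = min (min \<delta>1 \<delta>2) (min \<delta>3 (\<epsilon> / M)) / 2"
    have "2 * \<delta> \<le> \<epsilon> / M" by (simp add: \<delta>_def)
    then have \<delta>: "\<delta> > 0" "2 * \<delta> \<le> \<delta>1" "2 * \<delta> \<le> \<delta>2" "2 * \<delta> \<le> \<delta>3" "M * (2 * \<delta>) \<le> \<epsilon>"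
      using \<delta>1(1) \<delta>2(1) \<delta>3(1) \<epsilon>(1) M(1) by (auto simp: \<delta>_def pos_le_divide_eq mult.commute)
    show "\<exists>\<delta>>0. \<forall>u \<in> P \<inter> ball ubar \<delta>. \<forall>u' \<in> P \<inter> ball ubar \<delta>.
              \<forall>y \<in> ball (xbar, \<mu>bar) \<delta>. \<forall>y' \<in> ball (xbar, \<mu>bar) \<delta>.
              dist (residual y u) (residual y' u') \<le> \<epsilon>0 * dist y y' + (2 * M + 3) * dist u u'"
    proof (intro exI[of _ \<delta>] conjI ballI \<delta>(1))
      fix u u' y y'
      assume uu: "u \<in> P \<inter> ball ubar \<delta>" "u' \<in> P \<inter> ball ubar \<delta>"
        and yy: "y \<in> ball (xbar, \<mu>bar) \<delta>" "y' \<in> ball (xbar, \<mu>bar) \<delta>"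
      obtain x \<mu> where y: "y = (x, \<mu>)" by fastforce
      obtain x' \<mu>' where y': "y' = (x', \<mu>')" by fastforce
      have dx: "dist xbar x < \<delta>" "dist xbar x' < \<delta>" "dist \<mu>bar \<mu> < \<delta>" "dist \<mu>bar \<mu>' < \<delta>"
        using yy dist_fst_le[of "(xbar, \<mu>bar)" y] dist_fst_le[of "(xbar, \<mu>bar)" y']
          dist_snd_le[of "(xbar, \<mu>bar)" y] dist_snd_le[of "(xbar, \<mu>bar)" y'] by (auto simp: y y')
      let ?a = "(x, u)" and ?b = "(x', u')"
      have ball: "?a \<in> (UNIV \<times> P) \<inter> ball ?p (2 * \<delta>)" "?b \<in> (UNIV \<times> P) \<inter> ball ?p (2 * \<delta>)"
      proof -
        have "dist ?p ?a \<le> dist xbar x + dist ubar u" "dist ?p ?b \<le> dist xbar x' + dist ubar u'"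
          using sqrt_sum_squares_le_sum[of "dist xbar x" "dist ubar u"]
            sqrt_sum_squares_le_sum[of "dist xbar x'" "dist ubar u'"] by (auto simp: dist_Pair_Pair)
        then show "?a \<in> (UNIV \<times> P) \<inter> ball ?p (2 * \<delta>)" "?b \<in> (UNIV \<times> P) \<inter> ball ?p (2 * \<delta>)"
          using dx uu by auto
      qed
      have sub: "ball ?p (2 * \<delta>) \<subseteq> ball ?p \<delta>'" if "2 * \<delta> \<le> \<delta>'" for \<delta>' using that by (rule subset_ball)
      define X N W where "X = norm (x - x')" and "N = norm (\<mu> - \<mu>')" and "W = norm (u - u')"
      have XNW: "X \<ge> 0" "N \<ge> 0" "W \<ge> 0" by (auto simp: X_def N_def W_def)
      have nab: "norm (?a - ?b) \<le> X + W"
        using norm_Pair_le[of "x - x'" "u - u'"] by (simp add: X_def W_def)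
      have e1: "norm (hess (x - x') - (grad_lagr ?a - grad_lagr ?b)) \<le> \<epsilon> * (X + W) + M * W"
      proof -
        \<comment> \<open>\<open>hess\<close> covers only the part of \<open>h' ?p\<close> in the
          direction of \<open>x\<close>; the part in the direction of \<open>u\<close> remains and
          is bounded by \<open>M * W\<close>.\<close>
        have "hess (x - x') - (grad_lagr ?a - grad_lagr ?b) =
           - (grad_lagr ?a - grad_lagr ?b - h' ?p (?a - ?b)) - h' ?p (0, u - u')"
          by (simp add: hess flip: blinfun.diff_right)
        also have "norm \<dots> \<le> norm (grad_lagr ?a - grad_lagr ?b - h' ?p (?a - ?b)) + norm (h' ?p (0, u - u'))"
          by (metis norm_minus_cancel norm_triangle_ineq4)
        also have "\<dots> \<le> \<epsilon> * norm (?a - ?b) + norm (h' ?p) * norm (0 :: 'x, u - u')"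
          using ball sub \<delta> by (intro add_mono norm_blinfun \<delta>1) blast+
        also have "\<dots> \<le> \<epsilon> * (X + W) + M * W"
          using nab \<epsilon> M XNW by (intro add_mono mult_left_mono mult_mono) (auto simp: W_def norm_Pair)
        finally show ?thesis .
      qed
      have e2: "norm (\<Upsilon> ?a - \<Upsilon> ?b - \<Upsilon>' ?p (x - x', 0)) \<le> \<epsilon> * (X + W) + M * W"
      proof -
        have "\<Upsilon> ?a - \<Upsilon> ?b - \<Upsilon>' ?p (x - x', 0) =
           (\<Upsilon> ?a - \<Upsilon> ?b - \<Upsilon>' ?p (?a - ?b)) + \<Upsilon>' ?p (0, u - u')"
          by (simp add: algebra_simps flip: blinfun.add_right blinfun.diff_right)
        also have "norm \<dots> \<le> norm (\<Upsilon> ?a - \<Upsilon> ?b - \<Upsilon>' ?p (?a - ?b)) + norm (\<Upsilon>' ?p (0, u - u'))"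
          by (rule norm_triangle_ineq)
        also have "\<dots> \<le> \<epsilon> * norm (?a - ?b) + norm (\<Upsilon>' ?p) * norm (0 :: 'x, u - u')"
          using ball sub \<delta> by (intro add_mono norm_blinfun \<delta>2) blast+
        also have "\<dots> \<le> \<epsilon> * (X + W) + M * W"
          using nab \<epsilon> M XNW by (intro add_mono mult_left_mono mult_mono) (auto simp: W_def norm_Pair)
        finally show ?thesis .
      qed
      have e3: "norm (adjx (\<Upsilon>' ?p - \<Upsilon>' ?a) (\<mu> - \<mu>bar) - adjx (\<Upsilon>' ?p - \<Upsilon>' ?b) (\<mu>' - \<mu>bar))
         \<le> \<epsilon> * N + \<epsilon> * (X + W)"
      proof -
        \<comment> \<open>The difference of products is split so that each summand is a small factor
          times an increment.\<close>
        have "adjx (\<Upsilon>' ?p - \<Upsilon>' ?a) (\<mu> - \<mu>bar) - adjx (\<Upsilon>' ?p - \<Upsilon>' ?b) (\<mu>' - \<mu>bar) =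
            adjx (\<Upsilon>' ?p - \<Upsilon>' ?a) (\<mu> - \<mu>') - adjx (\<Upsilon>' ?a - \<Upsilon>' ?b) (\<mu>' - \<mu>bar)"
          by (simp add: adjx.diff_left adjx.diff_right)
        also have "norm \<dots> \<le> norm (\<Upsilon>' ?p - \<Upsilon>' ?a) * norm (\<mu> - \<mu>') + norm (\<Upsilon>' ?a - \<Upsilon>' ?b) * norm (\<mu>' - \<mu>bar)"
          by (rule order_trans[OF norm_triangle_ineq4 add_mono[OF norm_adjx_le norm_adjx_le]])
        also have "\<dots> \<le> (M * norm (?p - ?a)) * N + (M * norm (?a - ?b)) * norm (\<mu>' - \<mu>bar)"
          unfolding N_def using ball sub[OF \<delta>(4)] \<delta> ubar by (intro add_mono mult_right_mono \<Upsilon>'_lip) auto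
        also have "\<dots> \<le> (M * (2 * \<delta>)) * N + (M * (X + W)) * (2 * \<delta>)"
          using ball dx nab M XNW \<delta>(1)
          by (intro add_mono mult_mono mult_left_mono mult_nonneg_nonneg)
             (auto simp: dist_norm norm_minus_commute)
        also have "\<dots> = (M * (2 * \<delta>)) * N + (M * (2 * \<delta>)) * (X + W)" by simp
        also have "\<dots> \<le> \<epsilon> * N + \<epsilon> * (X + W)"
          using \<delta>(5) XNW by (intro add_mono mult_right_mono) auto
        finally show ?thesis .
      qed
      have hd: "hess (x - xbar) - hess (x' - xbar) = hess (x - x')"
        unfolding hess by (simp flip: blinfun.diff_right)
      have f: "fst (residual y u) - fst (residual y' u') = (hess (x - x') - (grad_lagr ?a - grad_lagr ?b))
         + (adjx (\<Upsilon>' ?p - \<Upsilon>' ?a) (\<mu> - \<mu>bar) - adjx (\<Upsilon>' ?p - \<Upsilon>' ?b) (\<mu>' - \<mu>bar))"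
        by (simp add: residual_def grad_lagr_def y y' adjx.diff_left adjx.diff_right flip: hd)
      have s: "snd (residual y u) - snd (residual y' u') = \<Upsilon> ?a - \<Upsilon> ?b - \<Upsilon>' ?p (x - x', 0)"
      proof -
        have "\<Upsilon>' ?p (x - xbar, 0) - \<Upsilon>' ?p (x' - xbar, 0) = \<Upsilon>' ?p (x - x', 0)"
          by (simp flip: blinfun.diff_right)
        then show ?thesis by (simp add: residual_def y y' algebra_simps)
      qed
      have "dist (residual y u) (residual y' u') \<le>
          norm (fst (residual y u) - fst (residual y' u')) + norm (snd (residual y u) - snd (residual y' u'))"
        using norm_Pair_le[of "fst (residual y u - residual y' u')" "snd (residual y u - residual y' u')"]
        by (simp add: dist_norm norm_prod_def)
      also have "\<dots> \<le> ((\<epsilon> * (X + W) + M * W) + (\<epsilon> * N + \<epsilon> * (X + W))) + (\<epsilon> * (X + W) + M * W)"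
        unfolding f s by (intro add_mono order_trans[OF norm_triangle_ineq] e1 e2 e3)
      also have "\<dots> = 3 * \<epsilon> * X + \<epsilon> * N + 3 * \<epsilon> * W + 2 * M * W"
        by (simp add: algebra_simps)
      also have "\<dots> \<le> 3 * \<epsilon> * dist y y' + \<epsilon> * dist y y' + 3 * 1 * W + 2 * M * W"
      proof -
        have "X \<le> dist y y'" "N \<le> dist y y'"
          using dist_fst_le[of y y'] dist_snd_le[of y y'] by (auto simp: X_def N_def y y' dist_norm)
        then show ?thesis using \<epsilon> XNW M(1) by (intro add_mono mult_mono mult_left_mono) auto
      qed
      also have "\<dots> = 4 * \<epsilon> * dist y y' + (2 * M + 3) * W" by (simp add: algebra_simps)
      also have "\<dots> \<le> \<epsilon>0 * dist y y' + (2 * M + 3) * dist u u'"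
        using \<epsilon> by (intro add_mono mult_right_mono) (auto simp: W_def dist_norm)
      finally show "dist (residual y u) (residual y' u') \<le> \<epsilon>0 * dist y y' + (2 * M + 3) * dist u u'" .
    qed
  qed
qed

end

section \<open>Partial derivatives and the linearized KKT system\<close>

text \<open>The slice of constant \<open>u\<close> lies in \<open>UNIV \<times> P\<close> and is
  full in \<open>x\<close>, so the relative derivative restricts to an unrestricted one.\<close>

lemma has_derivative_partial:
  assumes "(f has_derivative f') (at (x, u) within UNIV \<times> P)" "u \<in> P"
  shows "((\<lambda>x. f (x, u)) has_derivative (\<lambda>d. f' (d, 0))) (at x)"
proof -
  have "((\<lambda>x. (x, u)) has_derivative (\<lambda>d. (d, 0))) (at x)"
    by (auto intro!: derivative_eq_intros)
  moreover have "(f has_derivative f') (at (x, u) within (\<lambda>x. (x, u)) ` UNIV)"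
    by (rule has_derivative_subset[OF assms(1)]) (use assms(2) in auto)
  ultimately show ?thesis by (rule has_derivative_in_compose)
qed

lemma gradient_eqI:
  assumes "(f has_derivative (\<lambda>d. g \<bullet> d)) (at x)"
  shows "gradient f x = g"
proof -
  have g: "GDERIV f x :> g" using assms by (simp add: gderiv_def inner_commute)
  show ?thesis unfolding gradient_def
  proof (rule the_equality[of "\<lambda>g. GDERIV f x :> g", OF g])
    fix g' assume "GDERIV f x :> g'"
    then have "(\<lambda>d. d \<bullet> g') = (\<lambda>d. d \<bullet> g)"
      using g has_derivative_unique unfolding gderiv_def by blast
    then show "g' = g" by (metis vector_eq_ldot)
  qed
qed

context C2_problem
begin

lemma bounded_linear_hess: "bounded_linear hess"
  unfolding hess_def[abs_def]
  by (intro bounded_linear_add bounded_linear_compose[OF adjx.bounded_linear_left]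
      bounded_linear_compose[OF blinfun.bounded_linear_right] bounded_linear_Pair
      bounded_linear_ident bounded_linear_zero)

lemma gradient_eq:
  assumes "u \<in> P" shows "gradient (\<lambda>x. \<xi> (x, u)) x = adjx (\<xi>' (x, u)) 1"
  by (rule gradient_eqI)
     (use has_derivative_partial[OF \<xi>'[of "(x, u)"]] assms in \<open>simp add: inner_adjx\<close>)

lemma jacobian_eq:
  assumes "u \<in> P" shows "jacobian (\<lambda>x. \<Upsilon> (x, u)) x = (\<lambda>d. \<Upsilon>' (x, u) (d, 0))"
  using frechet_derivative_at[OF has_derivative_partial[OF \<Upsilon>'[of "(x, u)"]]] assms by simp

lemma jacobian_adj_eq:
  assumes "u \<in> P" shows "jacobian_adj (\<lambda>x. \<Upsilon> (x, u)) x = adjx (\<Upsilon>' (x, u))"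
  by (rule adjoint_unique) (metis inner_adjx inner_commute jacobian_eq[OF assms])

lemma gradient_lagrangian_eq:
  assumes "u \<in> P"
  shows "gradient (\<lambda>x. \<xi> (x, u) + \<mu>bar \<bullet> \<Upsilon> (x, u)) x = grad_lagr (x, u)"
proof (rule gradient_eqI, rule has_derivative_eq_rhs)
  show "((\<lambda>x. \<xi> (x, u) + \<mu>bar \<bullet> \<Upsilon> (x, u)) has_derivative
      (\<lambda>d. \<xi>' (x, u) (d, 0) + \<mu>bar \<bullet> \<Upsilon>' (x, u) (d, 0))) (at x)"
    using assms by (intro has_derivative_add has_derivative_inner_right
      has_derivative_partial[OF \<xi>'] has_derivative_partial[OF \<Upsilon>']) auto
qed (simp add: fun_eq_iff grad_lagr_def inner_add_left inner_adjx)

lemma frechet_derivative_gradient_lagrangian: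
  "frechet_derivative (gradient (\<lambda>x. \<xi> (x, ubar) + \<mu>bar \<bullet> \<Upsilon> (x, ubar))) (at xbar) = hess"
proof -
  obtain h' where h': "\<And>p. p \<in> UNIV \<times> P \<Longrightarrow> (grad_lagr has_derivative blinfun_apply (h' p)) (at p within UNIV \<times> P)"
    and "continuous_on (UNIV \<times> P) h'"
    and hess: "\<And>d. hess d = h' (xbar, ubar) (d, 0)"
    using grad_lagr_deriv by blast
  have "((\<lambda>x. grad_lagr (x, ubar)) has_derivative hess) (at xbar)"
    using has_derivative_partial[OF h'[OF bar_in]] ubar by (simp add: hess[abs_def])
  then have "frechet_derivative (\<lambda>x. grad_lagr (x, ubar)) (at xbar) = hess"
    by (rule frechet_derivative_at[symmetric])
  moreover have "gradient (\<lambda>x. \<xi> (x, ubar) + \<mu>bar \<bullet> \<Upsilon> (x, ubar)) = (\<lambda>x. grad_lagr (x, ubar))"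
    by (rule ext) (rule gradient_lagrangian_eq[OF ubar])
  ultimately show ?thesis by simp
qed

text \<open>The set \<open>linearized_kkt_solutions\<close> in terms of the derivatives of the
  locale, with the inclusion for \<open>subdifferential_inv\<close> solved for the point at which
  \<open>snd y\<close> is a subgradient.\<close>

definition lin_solutions :: "('z \<Rightarrow> ereal) \<Rightarrow> 'x \<times> 'z \<Rightarrow> ('x \<times> 'z) set" where
  "lin_solutions \<theta> p = {y.
     fst p = hess (fst y - xbar) + adjx (\<Upsilon>' (xbar, ubar)) (snd y - \<mu>bar) \<and>
     snd y \<in> subdifferential \<theta> (snd p + \<Upsilon> (xbar, ubar) + \<Upsilon>' (xbar, ubar) (fst y - xbar, 0))}"

text \<open>The linear terms of \<open>residual\<close> cancel those of the linearized system,
  leaving the KKT system at \<open>u\<close>. This is the form \<open>y \<in> F (r y u)\<close>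
  treated by \<open>Lipschitz_localization_perturbed\<close>.\<close>

lemma in_lin_solutions_residual_iff:
  "(x, \<mu>) \<in> lin_solutions \<theta> (residual (x, \<mu>) u) \<longleftrightarrow>
     adjx (\<xi>' (x, u)) 1 + adjx (\<Upsilon>' (x, u)) \<mu> = 0 \<and> \<mu> \<in> subdifferential \<theta> (\<Upsilon> (x, u))"
  unfolding lin_solutions_def residual_def
  by (auto simp: algebra_simps add_eq_0_iff)

lemma stationary_iff:
  assumes "u \<in> P"
  shows "stationary \<theta> (\<lambda>x. \<xi> (x, u)) (\<lambda>x. \<Upsilon> (x, u)) x \<longleftrightarrow>
    (\<exists>\<mu>. (x, \<mu>) \<in> lin_solutions \<theta> (residual (x, \<mu>) u))"
  unfolding stationary_def in_lin_solutions_residual_iff gradient_eq[OF assms] jacobian_adj_eq[OF assms]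
  by (auto simp: image_iff)

lemma linearized_kkt_solutions_eq:
  assumes "\<And>x. \<xi> (x, ubar) = \<phi>0 (x, wbar)" "\<And>x. \<Upsilon> (x, ubar) = \<Phi> (x, wbar)"
  shows "linearized_kkt_solutions \<phi>0 \<theta> \<Phi> wbar xbar \<mu>bar = lin_solutions \<theta>"
proof -
  have "hessian_lagrangian \<phi>0 \<Phi> xbar wbar \<mu>bar = hess"
    using frechet_derivative_gradient_lagrangian
    by (simp add: hessian_lagrangian_def lagrangian_def assms)
  moreover have J: "jacobian (\<lambda>y. \<Upsilon> (y, ubar)) xbar = (\<lambda>d. \<Upsilon>' (xbar, ubar) (d, 0))"
    by (rule jacobian_eq[OF ubar])
  moreover have "adjoint (\<lambda>d. \<Upsilon>' (xbar, ubar) (d, 0)) = adjx (\<Upsilon>' (xbar, ubar))"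
    using jacobian_adj_eq[OF ubar, of xbar] by (simp only: J)
  moreover have "v2 \<in> (\<lambda>z. - \<Upsilon> (xbar, ubar) - D + z) ` T \<longleftrightarrow> v2 + \<Upsilon> (xbar, ubar) + D \<in> T" for v2 D T
    by (auto simp: image_iff algebra_simps)
  ultimately show ?thesis
    unfolding linearized_kkt_solutions_def lin_solutions_def assms(2)[symmetric]
    by (auto intro!: ext simp: subdifferential_inv_def)
qed

end

section \<open>Stability under nondegeneracy\<close>

text \<open>Piecewise linearity of \<open>\<theta>\<close> and ND enter the stability argument only
  through these assumptions; \<open>S\<close> will be the space \<open>S_space\<close> at the
  reference value.\<close>

locale C2_KKT = C2_problem \<xi> \<Upsilon> P \<xi>' \<xi>'' \<Upsilon>' \<Upsilon>'' xbar ubar \<mu>bar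
  for \<xi> :: "'x::euclidean_space \<times> 'u::real_normed_vector \<Rightarrow> real"
    and \<Upsilon> :: "'x \<times> 'u \<Rightarrow> 'z::euclidean_space"
    and P \<xi>' \<xi>'' \<Upsilon>' \<Upsilon>'' xbar ubar \<mu>bar +
  fixes \<theta> :: "'z \<Rightarrow> ereal" and S :: "'z set"
  assumes S: "subspace S"
    and diff_S: "\<And>\<mu>. \<mu> \<in> subdifferential \<theta> (\<Upsilon> (xbar, ubar)) \<Longrightarrow> \<mu> - \<mu>bar \<in> S"
    and nondeg: "\<And>s. s \<in> S \<Longrightarrow> adjx (\<Upsilon>' (xbar, ubar)) s = 0 \<Longrightarrow> s = 0"
    and subdiff_mono: "\<exists>\<delta>>0. \<forall>z \<in> ball (\<Upsilon> (xbar, ubar)) \<delta>.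
          subdifferential \<theta> z \<subseteq> subdifferential \<theta> (\<Upsilon> (xbar, ubar))"
    and mubar: "\<mu>bar \<in> subdifferential \<theta> (\<Upsilon> (xbar, ubar))"
    and grad_lagr_bar: "grad_lagr (xbar, ubar) = 0"
begin

abbreviation "ybar \<equiv> (xbar, \<mu>bar)"

lemma residual_bar: "residual ybar ubar = (0, 0)"
proof -
  have "hess 0 = 0" by (rule linear_simps[OF bounded_linear_hess])
  moreover have "adjx (\<xi>' (xbar, ubar)) 1 = - adjx (\<Upsilon>' (xbar, ubar)) \<mu>bar"
    using grad_lagr_bar by (simp add: grad_lagr_def add_eq_0_iff2)
  ultimately show ?thesis
    by (simp add: residual_def adjx.zero_right blinfun.zero_right flip: zero_prod_def)
qed

lemma ybar_solution: "ybar \<in> lin_solutions \<theta> (0, 0)"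
  using in_lin_solutions_residual_iff[of xbar \<mu>bar \<theta> ubar] mubar grad_lagr_bar
  by (simp add: residual_bar grad_lagr_def)

text \<open>An injective linear map on a finite-dimensional subspace is bounded below.\<close>

lemma nondeg_bound:
  obtains c where "c > 0" "\<And>s. s \<in> S \<Longrightarrow> c * norm s \<le> norm (adjx (\<Upsilon>' (xbar, ubar)) s)"
  using injective_imp_isometric[OF closed_subspace[OF S] S adjx.bounded_linear_right] nondeg by metis

text \<open>Closeness of the multiplier is a conclusion here. By \<open>subdiff_mono\<close>,
  \<open>\<mu>\<close> is a subgradient at the reference value, so
  \<open>s = \<mu> - \<mu>bar\<close> lies in \<open>S\<close>. Stationarity bounds its image under
  the reference adjoint by a small multiple of \<open>norm s\<close> plus a small constant, and
  \<open>nondeg_bound\<close> then bounds \<open>s\<close>.\<close>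

lemma multiplier_near:
  assumes "\<rho> > 0"
  obtains \<delta> where "\<delta> > 0" "\<And>x \<mu> u. x \<in> ball xbar \<delta> \<Longrightarrow> u \<in> P \<inter> ball ubar \<delta> \<Longrightarrow>
     (x, \<mu>) \<in> lin_solutions \<theta> (residual (x, \<mu>) u) \<Longrightarrow> dist \<mu>bar \<mu> < \<rho> \<and> \<mu> - \<mu>bar \<in> S"
proof -
  let ?p = "(xbar, ubar)" and ?Q = "(UNIV :: 'x set) \<times> P"
  obtain c where c: "c > 0" "\<And>s. s \<in> S \<Longrightarrow> c * norm s \<le> norm (adjx (\<Upsilon>' ?p) s)"
    using nondeg_bound by blast
  obtain \<delta>0 where \<delta>0: "\<delta>0 > 0" "\<And>z. z \<in> ball (\<Upsilon> ?p) \<delta>0 \<Longrightarrow> subdifferential \<theta> z \<subseteq> subdifferential \<theta> (\<Upsilon> ?p)"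
    using subdiff_mono by blast
  obtain h' where h': "\<And>p. p \<in> ?Q \<Longrightarrow> (grad_lagr has_derivative blinfun_apply (h' p)) (at p within ?Q)"
    and "continuous_on ?Q h'" "\<And>d. hess d = h' ?p (d, 0)"
    using grad_lagr_deriv by blast
  have "continuous_on ?Q \<Upsilon>" "continuous_on ?Q \<Upsilon>'" "continuous_on ?Q grad_lagr"
    using \<Upsilon>' \<Upsilon>'' h' has_derivative_continuous continuous_on_eq_continuous_within by metis+
  then have "\<forall>\<epsilon>>0. \<exists>\<delta>>0. \<forall>a\<in>?Q. dist a ?p < \<delta> \<longrightarrow> dist (\<Upsilon> a) (\<Upsilon> ?p) < \<epsilon>"
    "\<forall>\<epsilon>>0. \<exists>\<delta>>0. \<forall>a\<in>?Q. dist a ?p < \<delta> \<longrightarrow> dist (\<Upsilon>' a) (\<Upsilon>' ?p) < \<epsilon>"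
    "\<forall>\<epsilon>>0. \<exists>\<delta>>0. \<forall>a\<in>?Q. dist a ?p < \<delta> \<longrightarrow> dist (grad_lagr a) (grad_lagr ?p) < \<epsilon>"
    using bar_in unfolding continuous_on_iff by blast+
  \<comment> \<open>Half of the lower bound \<open>c\<close> absorbs the variation of
    \<open>\<Upsilon>'\<close>; the other half turns the bound on \<open>grad_lagr\<close> into
    \<open>norm s < \<rho>\<close>.\<close>
  moreover have "c / 2 > 0" "c / 2 * \<rho> > 0" using c assms by auto
  ultimately obtain \<delta>1 \<delta>2 \<delta>3 where \<delta>s: "\<delta>1 > 0" "\<delta>2 > 0" "\<delta>3 > 0"
    and d1: "\<And>a. a \<in> ?Q \<Longrightarrow> dist a ?p < \<delta>1 \<Longrightarrow> dist (\<Upsilon> a) (\<Upsilon> ?p) < \<delta>0"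
    and d2: "\<And>a. a \<in> ?Q \<Longrightarrow> dist a ?p < \<delta>2 \<Longrightarrow> dist (\<Upsilon>' a) (\<Upsilon>' ?p) < c / 2"
    and d3: "\<And>a. a \<in> ?Q \<Longrightarrow> dist a ?p < \<delta>3 \<Longrightarrow> dist (grad_lagr a) (grad_lagr ?p) < c / 2 * \<rho>"
    using \<delta>0(1) by metis
  define \<delta> where "\<delta> = min \<delta>1 (min \<delta>2 \<delta>3) / 2"
  show thesis
  proof (rule that[of \<delta>])
    show "\<delta> > 0" using \<delta>s by (simp add: \<delta>_def)
    fix x \<mu> u assume x: "x \<in> ball xbar \<delta>" and u: "u \<in> P \<inter> ball ubar \<delta>"
      and sol: "(x, \<mu>) \<in> lin_solutions \<theta> (residual (x, \<mu>) u)"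
    let ?a = "(x, u)"
    have "dist ?a ?p \<le> dist x xbar + dist u ubar"
      using sqrt_sum_squares_le_sum[of "dist x xbar" "dist u ubar"] by (simp add: dist_Pair_Pair)
    then have "dist ?a ?p < 2 * \<delta>" using x u by (simp add: dist_commute)
    then have da: "dist ?a ?p < \<delta>1" "dist ?a ?p < \<delta>2" "dist ?a ?p < \<delta>3" by (auto simp: \<delta>_def)
    have aQ: "?a \<in> ?Q" using u by auto
    have eq: "adjx (\<xi>' ?a) 1 + adjx (\<Upsilon>' ?a) \<mu> = 0" and \<mu>: "\<mu> \<in> subdifferential \<theta> (\<Upsilon> ?a)"
      using sol in_lin_solutions_residual_iff by blast+
    have "\<mu> \<in> subdifferential \<theta> (\<Upsilon> ?p)"
      using \<mu> \<delta>0(2)[of "\<Upsilon> ?a"] d1[OF aQ da(1)] by (auto simp: dist_commute)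
    then have sS: "\<mu> - \<mu>bar \<in> S" by (rule diff_S)
    define s where "s = \<mu> - \<mu>bar"
    \<comment> \<open>The stationarity equation reads
      \<open>grad_lagr ?a + adjx (\<Upsilon>' ?a) s = 0\<close>.\<close>
    have "adjx (\<Upsilon>' ?p) s = - adjx (\<Upsilon>' ?a - \<Upsilon>' ?p) s - grad_lagr ?a"
      using eq by (simp add: s_def grad_lagr_def adjx.diff_left adjx.diff_right algebra_simps add_eq_0_iff)
    then have "norm (adjx (\<Upsilon>' ?p) s) \<le> norm (adjx (\<Upsilon>' ?a - \<Upsilon>' ?p) s) + norm (grad_lagr ?a)"
      by (metis norm_minus_cancel norm_triangle_ineq4)
    also have "\<dots> \<le> norm (\<Upsilon>' ?a - \<Upsilon>' ?p) * norm s + norm (grad_lagr ?a)"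
      by (simp add: norm_adjx_le)
    also have "\<dots> \<le> c / 2 * norm s + norm (grad_lagr ?a)"
      using d2[OF aQ da(2)] by (intro add_right_mono mult_right_mono) (auto simp: dist_norm)
    also have "\<dots> < c / 2 * norm s + c / 2 * \<rho>"
      using d3[OF aQ da(3)] by (simp add: grad_lagr_bar)
    finally have "c * norm s < c / 2 * norm s + c / 2 * \<rho>"
      using c(2)[of s] sS by (simp add: s_def)
    then have "c * norm s < c * \<rho>" by simp
    then have "norm s < \<rho>" using c(1) by simp
    then show "dist \<mu>bar \<mu> < \<rho> \<and> \<mu> - \<mu>bar \<in> S"
      using sS by (simp add: s_def dist_norm norm_minus_commute)
  qed
qed

section \<open>Transfer between the linearized system and stationary points\<close>

text \<open>The perturbation lemma with \<open>r = residual\<close> yields a locally unique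
  Lipschitz KKT pair \<open>\<sigma> u\<close>, and \<open>X\<close> is its first component.
  Uniqueness among stationary points, whose multipliers are not restricted, comes from
  \<open>multiplier_near\<close>.\<close>

lemma stable_if_Lipschitz_localization:
  assumes loc: "Lipschitz_localization (lin_solutions \<theta>) (0, 0) ybar"
  shows "\<exists>U N X. openin (top_of_set P) U \<and> ubar \<in> U \<and> open N \<and> xbar \<in> N \<and>
        (\<forall>u \<in> U. X u \<in> N \<and> stationary \<theta> (\<lambda>x. \<xi> (x, u)) (\<lambda>x. \<Upsilon> (x, u)) (X u) \<and>
           (\<forall>y \<in> N. stationary \<theta> (\<lambda>x. \<xi> (x, u)) (\<lambda>x. \<Upsilon> (x, u)) y \<longrightarrow> y = X u)) \<and>
        (\<exists>U' K. openin (top_of_set P) U' \<and> ubar \<in> U' \<and> U' \<subseteq> U \<and> K-lipschitz_on U' X)"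
proof -
  obtain L where L: "\<And>\<epsilon>. \<epsilon> > 0 \<Longrightarrow> \<exists>\<delta>>0. \<forall>u \<in> P \<inter> ball ubar \<delta>. \<forall>u' \<in> P \<inter> ball ubar \<delta>.
              \<forall>y \<in> ball ybar \<delta>. \<forall>y' \<in> ball ybar \<delta>.
              dist (residual y u) (residual y' u') \<le> \<epsilon> * dist y y' + L * dist u u'"
    using residual_estimate by blast
  obtain \<rho> \<delta> \<sigma> K where \<rho>: "\<rho> > 0" "\<delta> > 0"
    and \<sigma>: "\<And>u. u \<in> P \<inter> ball ubar \<delta> \<Longrightarrow> \<sigma> u \<in> ball ybar \<rho> \<and> \<sigma> u \<in> lin_solutions \<theta> (residual (\<sigma> u) u)"
    and \<sigma>u: "\<And>u y. u \<in> P \<inter> ball ubar \<delta> \<Longrightarrow> y \<in> ball ybar \<rho> \<Longrightarrow>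
        y \<in> lin_solutions \<theta> (residual y u) \<Longrightarrow> y = \<sigma> u"
    and K: "K-lipschitz_on (P \<inter> ball ubar \<delta>) \<sigma>"
    using Lipschitz_localization_perturbed[where r = residual, OF loc ybar_solution ubar residual_bar L] by blast
  have K0: "K \<ge> 0" using K lipschitz_on_nonneg by blast
  obtain \<delta>2 where \<delta>2: "\<delta>2 > 0" "\<And>x \<mu> u. x \<in> ball xbar \<delta>2 \<Longrightarrow> u \<in> P \<inter> ball ubar \<delta>2 \<Longrightarrow>
     (x, \<mu>) \<in> lin_solutions \<theta> (residual (x, \<mu>) u) \<Longrightarrow> dist \<mu>bar \<mu> < \<rho> / 2 \<and> \<mu> - \<mu>bar \<in> S"
    using multiplier_near[of "\<rho> / 2"] \<rho> by (metis half_gt_zero)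
  \<comment> \<open>A point within \<open>m\<close> and its multiplier within
    \<open>\<rho> / 2\<close> form a pair in the ball where \<open>\<sigma> u\<close> is
    unique.\<close>
  define m where "m = min \<delta>2 (\<rho> / 2)"
  have m: "m > 0" "m \<le> \<delta>2" "m \<le> \<rho> / 2" using \<delta>2 \<rho> by (auto simp: m_def)
  \<comment> \<open>The last bound keeps the first component of \<open>\<sigma> u\<close> within
    \<open>m\<close> of \<open>xbar\<close>; \<open>K + 1\<close> guards against
    \<open>K = 0\<close>.\<close>
  define \<eta> where "\<eta> = min (min \<delta> \<delta>2) (m / (K + 1))"
  have \<eta>: "\<eta> > 0" "\<eta> \<le> \<delta>" "\<eta> \<le> \<delta>2" "\<eta> \<le> m / (K + 1)" using \<rho> \<delta>2 m K0 by (auto simp: \<eta>_def)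
  define U where "U = P \<inter> ball ubar \<eta>"
  have U1: "u \<in> P" "u \<in> P \<inter> ball ubar \<delta>" "u \<in> P \<inter> ball ubar \<delta>2" if "u \<in> U" for u
    using that \<eta> by (auto simp: U_def)
  have ubU: "ubar \<in> U" using ubar \<eta> by (simp add: U_def)
  have \<sigma>bar: "\<sigma> ubar = ybar"
    using \<sigma>u[of ubar ybar] U1(2)[OF ubU] \<rho> ybar_solution by (simp add: residual_bar)
  have \<sigma>N: "fst (\<sigma> u) \<in> ball xbar m" if "u \<in> U" for u
  proof -
    have "dist xbar (fst (\<sigma> u)) \<le> dist (\<sigma> ubar) (\<sigma> u)"
      using dist_fst_le[of "\<sigma> ubar" "\<sigma> u"] by (simp add: \<sigma>bar)
    also have "\<dots> \<le> K * dist ubar u" using lipschitz_onD[OF K U1(2)[OF ubU] U1(2)[OF that]] .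
    also have "\<dots> \<le> K * \<eta>" using that K0 by (intro mult_left_mono) (auto simp: U_def)
    also have "\<dots> < (K + 1) * \<eta>" using \<eta>(1) by (intro mult_strict_right_mono) auto
    also have "\<dots> \<le> m" using \<eta>(4) K0 by (simp add: field_simps)
    finally show ?thesis by simp
  qed
  have open_U: "openin (top_of_set P) U" unfolding U_def by (rule openin_open_Int) simp
  have "fst (\<sigma> u) \<in> ball xbar m \<and> stationary \<theta> (\<lambda>x. \<xi> (x, u)) (\<lambda>x. \<Upsilon> (x, u)) (fst (\<sigma> u)) \<and>
      (\<forall>y \<in> ball xbar m. stationary \<theta> (\<lambda>x. \<xi> (x, u)) (\<lambda>x. \<Upsilon> (x, u)) y \<longrightarrow> y = fst (\<sigma> u))" if "u \<in> U" for u
  proof (intro conjI ballI impI \<sigma>N that)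
    show "stationary \<theta> (\<lambda>x. \<xi> (x, u)) (\<lambda>x. \<Upsilon> (x, u)) (fst (\<sigma> u))"
      using \<sigma>[OF U1(2)[OF that]] unfolding stationary_iff[OF U1(1)[OF that]] by (metis prod.collapse)
    fix y assume y: "y \<in> ball xbar m" and "stationary \<theta> (\<lambda>x. \<xi> (x, u)) (\<lambda>x. \<Upsilon> (x, u)) y"
    then obtain \<mu> where \<mu>: "(y, \<mu>) \<in> lin_solutions \<theta> (residual (y, \<mu>) u)"
      using stationary_iff[OF U1(1)[OF \<open>u \<in> U\<close>]] by blast
    have "dist \<mu>bar \<mu> < \<rho> / 2" using \<delta>2(2)[OF _ U1(3)[OF that] \<mu>] y m by auto
    moreover have "dist ybar (y, \<mu>) \<le> dist xbar y + dist \<mu>bar \<mu>"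
      using sqrt_sum_squares_le_sum[of "dist xbar y" "dist \<mu>bar \<mu>"] by (simp add: dist_Pair_Pair)
    ultimately have "(y, \<mu>) \<in> ball ybar \<rho>" using y m by simp
    then have "(y, \<mu>) = \<sigma> u" using \<sigma>u[OF U1(2)[OF that]] \<mu> by blast
    then show "y = fst (\<sigma> u)" by (metis fst_conv)
  qed
  moreover have "K-lipschitz_on U (\<lambda>u. fst (\<sigma> u))"
  proof (rule lipschitz_onI[OF _ K0])
    fix u u' assume "u \<in> U" "u' \<in> U"
    then have "dist (\<sigma> u) (\<sigma> u') \<le> K * dist u u'" using lipschitz_onD[OF K] U1 by blast
    then show "dist (fst (\<sigma> u)) (fst (\<sigma> u')) \<le> K * dist u u'"
      using dist_fst_le[of "\<sigma> u" "\<sigma> u'"] by linarith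
  qed
  ultimately show ?thesis
    using open_U ubU m(1)
    by (intro exI[of _ U] exI[of _ "ball xbar m"] exI[of _ "\<lambda>u. fst (\<sigma> u)"] conjI ballI exI[of _ K]) auto
qed

text \<open>\<open>E\<close> realizes a right-hand side \<open>p\<close> as a parameter. The
  stationary points \<open>X (E p)\<close> with their multipliers first localize the nonlinear
  system \<open>G\<close>; the perturbation lemma with the residual subtracted then returns to the
  linearized system.\<close>

lemma Lipschitz_localization_if_stable:
  assumes E0: "E (0, 0) = ubar" and EP: "\<And>p. E p \<in> P" and E_lip: "\<And>p p'. dist (E p) (E p') \<le> KE * dist p p'"
    and E_res: "\<And>p y. residual y (E p) = residual y ubar + p"
    and U: "openin (top_of_set P) U" "ubar \<in> U" and N: "open N" "xbar \<in> N"
    and X: "\<And>u. u \<in> U \<Longrightarrow> X u \<in> N \<and> stationary \<theta> (\<lambda>x. \<xi> (x, u)) (\<lambda>x. \<Upsilon> (x, u)) (X u)"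
    and X_unique: "\<And>u y. u \<in> U \<Longrightarrow> y \<in> N \<Longrightarrow> stationary \<theta> (\<lambda>x. \<xi> (x, u)) (\<lambda>x. \<Upsilon> (x, u)) y \<Longrightarrow> y = X u"
    and X_lip: "K-lipschitz_on U X"
  shows "Lipschitz_localization (lin_solutions \<theta>) (0, 0) ybar"
proof -
  define G where "G p = {y. y \<in> lin_solutions \<theta> (residual y (E p))}" for p
  have G: "y \<in> G p \<longleftrightarrow> y \<in> lin_solutions \<theta> (residual y ubar + p)" for y p
    by (simp add: G_def E_res)
  obtain L where L: "\<And>\<epsilon>. \<epsilon> > 0 \<Longrightarrow> \<exists>\<delta>>0. \<forall>u \<in> P \<inter> ball ubar \<delta>. \<forall>u' \<in> P \<inter> ball ubar \<delta>.
              \<forall>y \<in> ball ybar \<delta>. \<forall>y' \<in> ball ybar \<delta>.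
              dist (residual y u) (residual y' u') \<le> \<epsilon> * dist y y' + L * dist u u'"
    using residual_estimate by blast
  have res_small: "\<exists>\<delta>>0. \<forall>y \<in> ball ybar \<delta>. \<forall>y' \<in> ball ybar \<delta>.
      dist (residual y ubar) (residual y' ubar) \<le> \<epsilon> * dist y y'" if "\<epsilon> > 0" for \<epsilon>
  proof -
    obtain \<delta> where \<delta>: "\<delta> > 0" and est: "\<forall>u \<in> P \<inter> ball ubar \<delta>. \<forall>u' \<in> P \<inter> ball ubar \<delta>.
              \<forall>y \<in> ball ybar \<delta>. \<forall>y' \<in> ball ybar \<delta>.
              dist (residual y u) (residual y' u') \<le> \<epsilon> * dist y y' + L * dist u u'"
      using L[OF \<open>\<epsilon> > 0\<close>] by blast
    have "dist (residual y ubar) (residual y' ubar) \<le> \<epsilon> * dist y y' + L * dist ubar ubar"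
      if "y \<in> ball ybar \<delta>" "y' \<in> ball ybar \<delta>" for y y'
      using est ubar \<delta> that by (metis IntI centre_in_ball)
    then show ?thesis using \<delta> by (intro exI[of _ \<delta>]) simp
  qed
  have K: "K \<ge> 0" using X_lip lipschitz_on_nonneg by blast
  define KE' where "KE' = \<bar>KE\<bar> + 1"
  have KE': "KE' > 0" by (simp add: KE'_def)
  have E_lip': "dist (E p) (E p') \<le> KE' * dist p p'" for p p'
  proof -
    have "KE * dist p p' \<le> KE' * dist p p'" by (intro mult_right_mono) (auto simp: KE'_def)
    then show ?thesis using E_lip[of p p'] by linarith
  qed
  obtain c where c: "c > 0" "\<And>s. s \<in> S \<Longrightarrow> c * norm s \<le> norm (adjx (\<Upsilon>' (xbar, ubar)) s)"
    using nondeg_bound by blast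
  obtain KH where KH: "KH > 0" "\<And>d. norm (hess d) \<le> norm d * KH"
    using bounded_linear.pos_bounded[OF bounded_linear_hess] by blast
  have hess_diff: "hess d - hess d' = hess (d - d')" for d d'
    by (simp add: linear_simps[OF bounded_linear_hess])
  \<comment> \<open>The constant \<open>c / 2\<close> allows the multiplier part of the residual to
    be absorbed by the lower bound \<open>c\<close> on \<open>S\<close>.\<close>
  obtain \<delta>1 where \<delta>1: "\<delta>1 > 0" "\<And>y y'. y \<in> ball ybar \<delta>1 \<Longrightarrow> y' \<in> ball ybar \<delta>1 \<Longrightarrow>
      dist (residual y ubar) (residual y' ubar) \<le> c / 2 * dist y y'"
    using res_small[of "c / 2"] c(1) by (metis half_gt_zero)
  obtain \<delta>2 where \<delta>2: "\<delta>2 > 0" "\<And>x \<mu> u. x \<in> ball xbar \<delta>2 \<Longrightarrow> u \<in> P \<inter> ball ubar \<delta>2 \<Longrightarrow>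
     (x, \<mu>) \<in> lin_solutions \<theta> (residual (x, \<mu>) u) \<Longrightarrow> dist \<mu>bar \<mu> < \<delta>1 / 2 \<and> \<mu> - \<mu>bar \<in> S"
    using multiplier_near[of "\<delta>1 / 2"] \<delta>1(1) by (metis half_gt_zero)
  obtain \<delta>3 where \<delta>3: "\<delta>3 > 0" "ball xbar \<delta>3 \<subseteq> N" using N open_contains_ball by blast
  obtain \<delta>4 where \<delta>4: "\<delta>4 > 0" "P \<inter> ball ubar \<delta>4 \<subseteq> U"
    using U unfolding openin_contains_ball by (metis Int_commute)
  define m where "m = min (min (\<delta>1 / 2) \<delta>2) \<delta>3"
  have m: "m > 0" "m \<le> \<delta>1 / 2" "m \<le> \<delta>2" "m \<le> \<delta>3" using \<delta>1 \<delta>2 \<delta>3 by (auto simp: m_def)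
  \<comment> \<open>\<open>\<eta>'\<close> is a radius for parameters, chosen so that
    \<open>X\<close> stays within \<open>m\<close> of \<open>xbar\<close>; dividing it by
    \<open>KE'\<close> gives the radius \<open>\<eta>\<close> for \<open>p\<close>.\<close>
  define \<eta>' where "\<eta>' = min (min \<delta>2 \<delta>4) (m / (K + 1))"
  have \<eta>': "\<eta>' > 0" "\<eta>' \<le> \<delta>2" "\<eta>' \<le> \<delta>4" "\<eta>' \<le> m / (K + 1)" using \<delta>2 \<delta>4 m K by (auto simp: \<eta>'_def)
  define \<eta> where "\<eta> = \<eta>' / KE'"
  have \<eta>: "\<eta> > 0" using \<eta>' KE' by (simp add: \<eta>_def)
  define U0 where "U0 = ball (0 :: 'x, 0 :: 'z) \<eta>"
  define V0 where "V0 = ball xbar m \<times> ball \<mu>bar (\<delta>1 / 2)"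
  have E_ball: "E p \<in> P \<inter> ball ubar \<eta>'" if "p \<in> U0" for p
  proof -
    have "dist ubar (E p) \<le> KE' * dist (0, 0) p" using E_lip'[of "(0, 0)" p] by (simp add: E0)
    also have "\<dots> < KE' * \<eta>" using that KE' by (simp add: U0_def)
    also have "\<dots> = \<eta>'" using KE' by (simp add: \<eta>_def)
    finally show ?thesis using EP by simp
  qed
  have EU: "E p \<in> U" "E p \<in> P \<inter> ball ubar \<delta>2" if "p \<in> U0" for p
    using E_ball[OF that] \<eta>' \<delta>4 by auto
  have "stationary \<theta> (\<lambda>x. \<xi> (x, ubar)) (\<lambda>x. \<Upsilon> (x, ubar)) xbar"
    unfolding stationary_iff[OF ubar] using ybar_solution by (auto simp: residual_bar intro!: exI[of _ \<mu>bar])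
  then have Xbar: "X ubar = xbar" using X_unique[OF U(2) N(2)] by simp
  have XV: "X (E p) \<in> ball xbar m" if "p \<in> U0" for p
  proof -
    have "dist xbar (X (E p)) \<le> K * dist ubar (E p)"
      using lipschitz_onD[OF X_lip U(2) EU(1)[OF that]] by (simp add: Xbar)
    also have "\<dots> \<le> K * \<eta>'" using E_ball[OF that] K by (intro mult_left_mono) auto
    also have "\<dots> < (K + 1) * \<eta>'" using \<eta>'(1) by (intro mult_strict_right_mono) auto
    also have "\<dots> \<le> m" using \<eta>'(4) K by (simp add: field_simps)
    finally show ?thesis by simp
  qed
  have ex: "\<exists>y. y \<in> V0 \<and> y \<in> G p" if "p \<in> U0" for p
  proof -
    obtain \<mu> where \<mu>: "(X (E p), \<mu>) \<in> lin_solutions \<theta> (residual (X (E p), \<mu>) (E p))"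
      using X[OF EU(1)[OF \<open>p \<in> U0\<close>]] stationary_iff[OF EP] by blast
    then have "dist \<mu>bar \<mu> < \<delta>1 / 2" using \<delta>2(2)[OF _ EU(2)[OF that] \<mu>] XV[OF that] m by auto
    then show ?thesis using XV[OF that] \<mu> by (auto simp: V0_def G_def)
  qed
  define C where "C = K * KE'"
  have C: "C \<ge> 0" using K KE' by (simp add: C_def)
  \<comment> \<open>The summand \<open>C\<close> is the Lipschitz constant of \<open>x\<close>. The
    rest bounds the multiplier: it solves \<open>c / 2 * dist \<mu> \<mu>' \<le> dist p p' + (c / 2
    + KH) * dist x x'\<close> after inserting the bound on \<open>x\<close>.\<close>
  define K2 where "K2 = C + (2 / c) * (1 + (c / 2 + KH) * C)"
  have K2: "K2 \<ge> 0" using C c(1) KH(1) by (simp add: K2_def)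
  have est: "dist y y' \<le> K2 * dist p p'"
    if p: "p \<in> U0" "p' \<in> U0" and y: "y \<in> V0" "y \<in> G p" and y': "y' \<in> V0" "y' \<in> G p'" for p p' y y'
  proof -
    obtain x \<mu> where yx: "y = (x, \<mu>)" by fastforce
    obtain x' \<mu>' where yx': "y' = (x', \<mu>')" by fastforce
    have sol: "(x, \<mu>) \<in> lin_solutions \<theta> (residual (x, \<mu>) (E p))" "(x', \<mu>') \<in> lin_solutions \<theta> (residual (x', \<mu>') (E p'))"
      using y y' by (auto simp: G_def yx yx')
    have xm: "x \<in> ball xbar m" "x' \<in> ball xbar m" "\<mu> \<in> ball \<mu>bar (\<delta>1 / 2)" "\<mu>' \<in> ball \<mu>bar (\<delta>1 / 2)"
      using y y' by (auto simp: V0_def yx yx')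
    have "x \<in> N" "x' \<in> N" using xm m \<delta>3 by auto
    then have xX: "x = X (E p)" "x' = X (E p')"
      using X_unique EU(1)[OF p(1)] EU(1)[OF p(2)] sol stationary_iff[OF EP] by metis+
    have "dist (X (E p)) (X (E p')) \<le> K * dist (E p) (E p')" by (rule lipschitz_onD[OF X_lip EU(1)[OF p(1)] EU(1)[OF p(2)]])
    also have "\<dots> \<le> K * (KE' * dist p p')" using K E_lip' by (intro mult_left_mono)
    finally have dx: "dist x x' \<le> C * dist p p'" by (simp add: xX C_def mult.assoc)
    have "\<mu> - \<mu>bar \<in> S" "\<mu>' - \<mu>bar \<in> S"
      using \<delta>2(2)[OF _ EU(2)[OF p(1)] sol(1)] \<delta>2(2)[OF _ EU(2)[OF p(2)] sol(2)] xm m by auto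
    then have "\<mu> - \<mu>' \<in> S" using subspace_diff[OF S, of "\<mu> - \<mu>bar" "\<mu>' - \<mu>bar"] by simp
    then have 1: "c * norm (\<mu> - \<mu>') \<le> norm (adjx (\<Upsilon>' (xbar, ubar)) (\<mu> - \<mu>'))" by (rule c)
    let ?A = "adjx (\<Upsilon>' (xbar, ubar))"
    \<comment> \<open>Subtracting these two equations isolates the adjoint of the multiplier
      difference, which lies in \<open>S\<close>.\<close>
    have "fst (residual y ubar) + fst p = hess (x - xbar) + ?A (\<mu> - \<mu>bar)"
      "fst (residual y' ubar) + fst p' = hess (x' - xbar) + ?A (\<mu>' - \<mu>bar)"
      using y y' unfolding G lin_solutions_def by (auto simp: yx yx')
    then have "?A (\<mu> - \<mu>bar) - ?A (\<mu>' - \<mu>bar) = (fst p - fst p') + (fst (residual y ubar) - fst (residual y' ubar))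
        - (hess (x - xbar) - hess (x' - xbar))"
      by (simp add: algebra_simps)
    moreover have "?A (\<mu> - \<mu>bar) - ?A (\<mu>' - \<mu>bar) = ?A (\<mu> - \<mu>')" by (simp flip: adjx.diff_right)
    ultimately have "?A (\<mu> - \<mu>') = (fst p - fst p') + (fst (residual y ubar) - fst (residual y' ubar))
        - hess (x - x')"
      by (simp add: hess_diff)
    then have "norm (?A (\<mu> - \<mu>')) \<le> norm (fst p - fst p') + norm (fst (residual y ubar) - fst (residual y' ubar))
        + norm (hess (x - x'))"
      by (smt (verit) norm_triangle_ineq norm_triangle_ineq4)
    also have "\<dots> \<le> dist p p' + dist (residual y ubar) (residual y' ubar) + KH * dist x x'"
      using dist_fst_le[of p p'] dist_fst_le[of "residual y ubar" "residual y' ubar"] KH(2)[of "x - x'"]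
      by (simp add: dist_norm mult.commute)
    also have "\<dots> \<le> dist p p' + c / 2 * dist y y' + KH * dist x x'"
    proof -
      have "dist ybar y \<le> dist xbar x + dist \<mu>bar \<mu>" "dist ybar y' \<le> dist xbar x' + dist \<mu>bar \<mu>'"
        using sqrt_sum_squares_le_sum[of "dist xbar x" "dist \<mu>bar \<mu>"]
          sqrt_sum_squares_le_sum[of "dist xbar x'" "dist \<mu>bar \<mu>'"] by (auto simp: dist_Pair_Pair yx yx')
      then have "y \<in> ball ybar \<delta>1" "y' \<in> ball ybar \<delta>1" using xm m by auto
      then show ?thesis using \<delta>1(2) by simp
    qed
    finally have 2: "c * dist \<mu> \<mu>' \<le> dist p p' + c / 2 * dist y y' + KH * dist x x'"
      using 1 by (simp add: dist_norm)
    have 3: "dist y y' \<le> dist x x' + dist \<mu> \<mu>'"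
      using sqrt_sum_squares_le_sum[of "dist x x'" "dist \<mu> \<mu>'"] by (simp add: dist_Pair_Pair yx yx')
    have "c * dist \<mu> \<mu>' \<le> dist p p' + c / 2 * (dist x x' + dist \<mu> \<mu>') + KH * dist x x'"
      using 2 mult_left_mono[OF 3, of "c / 2"] c(1) by linarith
    then have "c / 2 * dist \<mu> \<mu>' \<le> dist p p' + (c / 2 + KH) * dist x x'"
      by (simp add: algebra_simps)
    also have "\<dots> \<le> dist p p' + (c / 2 + KH) * (C * dist p p')"
      using dx c(1) KH(1) by (intro add_left_mono mult_left_mono) auto
    also have "\<dots> = (1 + (c / 2 + KH) * C) * dist p p'" by (simp add: algebra_simps)
    finally have "(2 / c) * (c / 2 * dist \<mu> \<mu>') \<le> (2 / c) * ((1 + (c / 2 + KH) * C) * dist p p')"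
      using c(1) by (intro mult_left_mono) auto
    moreover have "(2 / c) * (c / 2 * dist \<mu> \<mu>') = dist \<mu> \<mu>'" using c(1) by simp
    ultimately have "dist \<mu> \<mu>' \<le> (2 / c) * (1 + (c / 2 + KH) * C) * dist p p'"
      by (simp only: mult.assoc)
    then show ?thesis using 3 dx by (simp add: K2_def distrib_right)
  qed
  have "Lipschitz_localization G (0, 0) ybar"
  proof -
    obtain s where s: "\<And>p. p \<in> U0 \<Longrightarrow> s p \<in> V0 \<and> s p \<in> G p" using ex by metis
    \<comment> \<open>Taking equal perturbations in \<open>est\<close> shows that the localization
      is single-valued.\<close>
    have "y = s p" if "p \<in> U0" "y \<in> V0" "y \<in> G p" for p y
      using est[OF that(1) that(1) that(2,3)] s[OF that(1)] by simp
    then have "{(p, y). y \<in> G p} \<inter> U0 \<times> V0 = {(p, s p) | p. p \<in> U0}" using s by blast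
    moreover have "K2-lipschitz_on U0 s"
      by (rule lipschitz_onI[OF _ K2]) (use est s in blast)
    moreover have "(0, 0) \<in> U0" using \<eta> by (simp add: U0_def)
    moreover have "open U0" "open V0" "ybar \<in> V0"
      using m(1) \<delta>1(1) by (auto simp: U0_def V0_def open_Times)
    ultimately show ?thesis unfolding Lipschitz_localization_def by blast
  qed
  note loc_G = this
  have G_bar: "ybar \<in> G (0, 0)" using ybar_solution by (simp add: G_def E0 residual_bar)
  have r_bar: "(0, 0) - residual ybar ubar = (0, 0)" unfolding residual_bar by (rule diff_self[of "(0, 0)", unfolded zero_prod_def])
  have r_lip: "\<exists>\<delta>>0. \<forall>u \<in> UNIV \<inter> ball (0, 0) \<delta>. \<forall>u' \<in> UNIV \<inter> ball (0, 0) \<delta>.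
              \<forall>y \<in> ball ybar \<delta>. \<forall>y' \<in> ball ybar \<delta>.
      dist (u - residual y ubar) (u' - residual y' ubar) \<le> \<epsilon> * dist y y' + 1 * dist u u'" if "\<epsilon> > 0" for \<epsilon>
  proof -
    have tri: "dist (u - residual y ubar) (u' - residual y' ubar) \<le> dist (residual y ubar) (residual y' ubar) + 1 * dist u u'"
      for u u' y y'
    proof -
      have eq: "u - residual y ubar - (u' - residual y' ubar) = (u - u') - (residual y ubar - residual y' ubar)" by simp
      show ?thesis
        unfolding dist_norm eq
        using norm_triangle_ineq4[of "u - u'" "residual y ubar - residual y' ubar"] by linarith
    qed
    obtain \<delta> where "\<delta> > 0" and \<delta>: "\<forall>y \<in> ball ybar \<delta>. \<forall>y' \<in> ball ybar \<delta>.
        dist (residual y ubar) (residual y' ubar) \<le> \<epsilon> * dist y y'"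
      using res_small[OF \<open>\<epsilon> > 0\<close>] by blast
    then show ?thesis
      by (intro exI[of _ \<delta>] conjI ballI order_trans[OF tri] add_right_mono) blast+
  qed
  \<comment> \<open>\<open>G\<close> adds \<open>residual y ubar\<close> to its argument, so
    evaluating it at \<open>p - residual y ubar\<close> gives exactly the linearized system for
    \<open>p\<close>.\<close>
  obtain \<rho> \<delta> \<sigma> K' where \<rho>: "\<rho> > 0" "\<delta> > 0"
    and \<sigma>: "\<And>p. p \<in> UNIV \<inter> ball (0, 0) \<delta> \<Longrightarrow> \<sigma> p \<in> ball ybar \<rho> \<and> \<sigma> p \<in> G (p - residual (\<sigma> p) ubar)"
    and \<sigma>u: "\<And>p y. p \<in> UNIV \<inter> ball (0, 0) \<delta> \<Longrightarrow> y \<in> ball ybar \<rho> \<Longrightarrow> y \<in> G (p - residual y ubar) \<Longrightarrow> y = \<sigma> p"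
    and K': "K'-lipschitz_on (UNIV \<inter> ball (0, 0) \<delta>) \<sigma>"
    by (rule Lipschitz_localization_perturbed[where r = "\<lambda>y p. p - residual y ubar" and L = 1,
          OF loc_G G_bar UNIV_I r_bar r_lip]) (assumption | rule that)+
  have "{(p, y). y \<in> lin_solutions \<theta> p} \<inter> ball (0, 0) \<delta> \<times> ball ybar \<rho> = {(p, \<sigma> p) | p. p \<in> ball (0, 0) \<delta>}"
    using \<sigma> \<sigma>u by (auto simp: G)
  then show ?thesis
    unfolding Lipschitz_localization_def using \<rho> K'
    by (intro exI[of _ "ball (0, 0) \<delta>"] exI[of _ "ball ybar \<rho>"] exI[of _ \<sigma>] exI[of _ K']) auto
qed

end

section \<open>Subdifferentials of convex piecewise linear functions\<close>

text \<open>For \<open>z\<close> in the domain near \<open>zbar\<close>, the reflected point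
  \<open>2 *\<^sub>R z - zbar\<close> is in the domain as well, and \<open>\<theta>\<close> there is
  at most \<open>2 * M z - M zbar\<close>. The subgradient inequality at \<open>z\<close>, tested at
  this point, yields \<open>M zbar + v \<bullet> (z - zbar) \<le> M z\<close>, which makes
  \<open>v\<close> a subgradient at \<open>zbar\<close>.\<close>

lemma cpwl_subdifferential_mono:
  fixes \<theta> :: "'z::euclidean_space \<Rightarrow> ereal"
  assumes "cpwl \<theta>" and zbar: "zbar \<in> edom \<theta>"
  shows "\<exists>\<delta>>0. \<forall>z \<in> ball zbar \<delta>. subdifferential \<theta> z \<subseteq> subdifferential \<theta> zbar"
proof -
  obtain A :: "('z \<times> real) set" where A: "finite A" "A \<noteq> {}"
    and \<theta>A: "\<forall>z \<in> edom \<theta>. \<theta> z = ereal (Max ((\<lambda>(a, b). a \<bullet> z + b) ` A))"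
    and poly: "polyhedron (edom \<theta>)"
    using assms(1) unfolding cpwl_def by blast
  define M where "M z = Max ((\<lambda>(a, b). a \<bullet> z + b) ` A)" for z
  have \<theta>M: "\<theta> z = ereal (M z)" if "z \<in> edom \<theta>" for z using \<theta>A that by (simp add: M_def)
  have M_ge: "a \<bullet> z + b \<le> M z" if "(a, b) \<in> A" for a b z
    unfolding M_def using A that by (intro Max_ge) (auto intro!: rev_image_eqI)
  have M_le: "M z \<le> c" if "\<And>a b. (a, b) \<in> A \<Longrightarrow> a \<bullet> z + b \<le> c" for z c
    unfolding M_def using A that by (subst Max_le_iff) auto
  have lim: "((\<lambda>z. a \<bullet> (2 *\<^sub>R z - zbar)) \<longlongrightarrow> a \<bullet> zbar) (nhds zbar)" for a
  proof (rule tendsto_eq_rhs)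
    show "((\<lambda>z. a \<bullet> (2 *\<^sub>R z - zbar)) \<longlongrightarrow> a \<bullet> (2 *\<^sub>R zbar - zbar)) (nhds zbar)"
      by (intro tendsto_intros filterlim_ident)
  qed (simp add: scaleR_2)
  have lim': "((\<lambda>z. a \<bullet> z) \<longlongrightarrow> a \<bullet> zbar) (nhds zbar)" for a
    by (intro tendsto_intros filterlim_ident)
  obtain F where F: "finite F" "edom \<theta> = \<Inter>F" "\<forall>h \<in> F. \<exists>a b. a \<noteq> 0 \<and> h = {x. a \<bullet> x \<le> b}"
    using poly unfolding polyhedron_def by (elim exE conjE) (rule that; assumption)
  \<comment> \<open>A half-space active at \<open>zbar\<close> is a cone with apex
    \<open>zbar\<close>, so doubling \<open>z - zbar\<close> does not leave it; an inactive one
    contains a neighborhood of \<open>zbar\<close>.\<close>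
  have ev_dom: "\<forall>\<^sub>F z in nhds zbar. \<forall>h \<in> F. z \<in> h \<longrightarrow> 2 *\<^sub>R z - zbar \<in> h"
  proof (rule eventually_ball_finite[OF F(1)], rule ballI)
    fix h assume h: "h \<in> F"
    then obtain a b where ab: "h = {x. a \<bullet> x \<le> b}" using F(3) by blast
    have "a \<bullet> zbar \<le> b" using zbar h ab F(2) by auto
    then consider "a \<bullet> zbar = b" | "a \<bullet> zbar < b" by linarith
    then show "\<forall>\<^sub>F z in nhds zbar. z \<in> h \<longrightarrow> 2 *\<^sub>R z - zbar \<in> h"
    proof cases
      case 1
      then show ?thesis by (simp add: ab inner_diff_right)
    next
      case 2
      show ?thesis using order_tendstoD(2)[OF lim 2] by eventually_elim (simp add: ab)
    qed
  qed
  obtain a0 b0 where ab0: "(a0, b0) \<in> A" "M zbar = a0 \<bullet> zbar + b0"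
  proof -
    have "M zbar \<in> (\<lambda>(a, b). a \<bullet> zbar + b) ` A" unfolding M_def using A by (intro Max_in) auto
    then show thesis using that by auto
  qed
  \<comment> \<open>For a piece active at \<open>zbar\<close> the bound holds at every
    \<open>z\<close> by affinity. For the others it is strict at \<open>zbar\<close> and persists
    nearby, with the active piece \<open>(a0, b0)\<close> as a continuous minorant of
    \<open>M\<close>.\<close>
  have ev_M: "\<forall>\<^sub>F z in nhds zbar. \<forall>ab \<in> A. fst ab \<bullet> (2 *\<^sub>R z - zbar) + snd ab \<le> 2 * M z - M zbar"
  proof (rule eventually_ball_finite[OF A(1)], rule ballI)
    fix ab assume "ab \<in> A"
    then obtain a b where ab: "ab = (a, b)" "(a, b) \<in> A" by (metis surj_pair)
    have "a \<bullet> zbar + b \<le> M zbar" using M_ge ab by blast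
    then consider "a \<bullet> zbar + b = M zbar" | "a \<bullet> zbar + b < M zbar" by linarith
    then show "\<forall>\<^sub>F z in nhds zbar. fst ab \<bullet> (2 *\<^sub>R z - zbar) + snd ab \<le> 2 * M z - M zbar"
    proof cases
      case 1
      have "a \<bullet> (2 *\<^sub>R z - zbar) + b \<le> 2 * M z - M zbar" for z
        using M_ge[OF ab(2), of z] 1 by (simp add: inner_diff_right)
      then show ?thesis by (simp add: ab)
    next
      case 2
      have "((\<lambda>z. (a \<bullet> (2 *\<^sub>R z - zbar) + b) - (2 * (a0 \<bullet> z + b0) - M zbar))
          \<longlongrightarrow> (a \<bullet> zbar + b) - (2 * (a0 \<bullet> zbar + b0) - M zbar)) (nhds zbar)"
        by (intro tendsto_intros lim lim')
      then have "\<forall>\<^sub>F z in nhds zbar. (a \<bullet> (2 *\<^sub>R z - zbar) + b) - (2 * (a0 \<bullet> z + b0) - M zbar) < 0"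
        by (rule order_tendstoD(2)) (use 2 ab0 in simp)
      then show ?thesis
      proof eventually_elim
        case (elim z)
        then show ?case using M_ge[OF ab0(1), of z] by (simp add: ab)
      qed
    qed
  qed
  obtain \<delta> where \<delta>: "\<delta> > 0" and near: "\<And>z. z \<in> ball zbar \<delta> \<Longrightarrow> (\<forall>h \<in> F. z \<in> h \<longrightarrow> 2 *\<^sub>R z - zbar \<in> h) \<and>
      (\<forall>ab \<in> A. fst ab \<bullet> (2 *\<^sub>R z - zbar) + snd ab \<le> 2 * M z - M zbar)"
    using eventually_conj[OF ev_dom ev_M] unfolding eventually_nhds_metric by (metis dist_commute mem_ball)
  have "v \<in> subdifferential \<theta> zbar" if z: "z \<in> ball zbar \<delta>" and v: "v \<in> subdifferential \<theta> z" for z v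
  proof -
    have v: "\<bar>\<theta> z\<bar> \<noteq> \<infinity>" "\<And>y. \<theta> z + ereal (v \<bullet> (y - z)) \<le> \<theta> y"
      using v unfolding subdifferential_def by auto
    then have ze: "z \<in> edom \<theta>" unfolding edom_def by (cases "\<theta> z") auto
    have z2: "2 *\<^sub>R z - zbar \<in> edom \<theta>" using near[OF z] ze unfolding F(2) by blast
    have "M (2 *\<^sub>R z - zbar) \<le> 2 * M z - M zbar" by (rule M_le) (use near[OF z] in force)
    moreover have "M z + v \<bullet> (2 *\<^sub>R z - zbar - z) \<le> M (2 *\<^sub>R z - zbar)"
      using v(2)[of "2 *\<^sub>R z - zbar"] by (simp add: \<theta>M[OF ze] \<theta>M[OF z2])
    moreover have "v \<bullet> (2 *\<^sub>R z - zbar - z) = v \<bullet> (z - zbar)" by (simp add: scaleR_2)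
    ultimately have le: "M zbar + v \<bullet> (z - zbar) \<le> M z" by linarith
    have "\<theta> zbar + ereal (v \<bullet> (y - zbar)) \<le> \<theta> y" for y
    proof -
      have "M zbar + v \<bullet> (y - zbar) \<le> M z + v \<bullet> (y - z)" using le by (simp add: inner_diff_right)
      then have "\<theta> zbar + ereal (v \<bullet> (y - zbar)) \<le> \<theta> z + ereal (v \<bullet> (y - z))"
        by (simp add: \<theta>M[OF ze] \<theta>M[OF zbar])
      then show ?thesis using v(2)[of y] by (rule order_trans)
    qed
    then show ?thesis by (simp add: subdifferential_def \<theta>M[OF zbar])
  qed
  then show ?thesis using \<delta> by blast
qed

text \<open>Convexity gives a nonempty subdifferential a nonempty relative interior.\<close>

lemma convex_subdifferential: "convex (subdifferential \<theta> z)"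
proof (rule convexI)
  fix v w and s t :: real
  assume v: "v \<in> subdifferential \<theta> z" and w: "w \<in> subdifferential \<theta> z" and st: "0 \<le> s" "0 \<le> t" "s + t = 1"
  obtain r where r: "\<theta> z = ereal r" using v unfolding subdifferential_def by (cases "\<theta> z") auto
  have "ereal (r + (s *\<^sub>R v + t *\<^sub>R w) \<bullet> (y - z)) \<le> \<theta> y" for y
  proof (cases "\<theta> y")
    case (real c)
    have "r + v \<bullet> (y - z) \<le> c" "r + w \<bullet> (y - z) \<le> c"
      using v w real r unfolding subdifferential_def by (auto dest!: spec[of _ y])
    then have "s * (r + v \<bullet> (y - z)) + t * (r + w \<bullet> (y - z)) \<le> s * c + t * c"
      using st by (intro add_mono mult_left_mono)
    moreover have "s * (r + v \<bullet> (y - z)) + t * (r + w \<bullet> (y - z)) =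
        (s + t) * r + (s *\<^sub>R v + t *\<^sub>R w) \<bullet> (y - z)"
      by (simp add: inner_add_left algebra_simps)
    moreover have "s * c + t * c = (s + t) * c" by (simp add: algebra_simps)
    ultimately show ?thesis using st real by simp
  next
    case MInf
    then show ?thesis using v r unfolding subdifferential_def by (auto dest!: spec[of _ y])
  qed simp
  then show "s *\<^sub>R v + t *\<^sub>R w \<in> subdifferential \<theta> z" by (simp add: subdifferential_def r)
qed

text \<open>Nonemptiness gives the affine hull a unique parallel subspace, so the definite
  description in \<open>parallel_subspace_of\<close> is meaningful; it is then a translate of the
  hull.\<close>

lemma S_space_props:
  assumes "subdifferential \<theta> z \<noteq> {}"
  shows subspace_S_space: "subspace (S_space \<theta> z)"
    and diff_in_S_space: "p \<in> affine hull (subdifferential \<theta> z) \<Longrightarrow> q \<in> affine hull (subdifferential \<theta> z)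
          \<Longrightarrow> p - q \<in> S_space \<theta> z"
    and affine_hull_add_S_space: "p \<in> affine hull (subdifferential \<theta> z) \<Longrightarrow> s \<in> S_space \<theta> z
          \<Longrightarrow> p + s \<in> affine hull (subdifferential \<theta> z)"
proof -
  let ?A = "affine hull (subdifferential \<theta> z)"
  have "\<exists>!L. subspace L \<and> affine_parallel ?A L"
    using assms by (intro affine_parallel_subspace) auto
  from theI'[OF this] have S: "subspace (S_space \<theta> z)" "affine_parallel ?A (S_space \<theta> z)"
    by (simp_all add: S_space_def parallel_subspace_of_def)
  then obtain a where a: "S_space \<theta> z = (\<lambda>x. a + x) ` ?A" unfolding affine_parallel_def by blast
  show "subspace (S_space \<theta> z)" by (rule S)
  show "p - q \<in> S_space \<theta> z" if "p \<in> ?A" "q \<in> ?A"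
  proof -
    have "a + p \<in> S_space \<theta> z" "a + q \<in> S_space \<theta> z" using that a by auto
    from subspace_diff[OF S(1) this] show ?thesis by simp
  qed
  show "p + s \<in> ?A" if "p \<in> ?A" "s \<in> S_space \<theta> z"
  proof -
    have "a + p \<in> S_space \<theta> z" using that a by auto
    from subspace_add[OF S(1) this that(2)] have "a + (p + s) \<in> (\<lambda>x. a + x) ` ?A"
      by (simp add: a add.assoc)
    then show ?thesis by auto
  qed
qed

section \<open>Nondegeneracy from strong regularity\<close>

context C2_problem
begin

text \<open>If \<open>s\<close> were a nonzero kernel direction, a point of the relative interior of the subdifferential
  close to \<open>\<mu>bar\<close> could be moved along \<open>s\<close> without changing the perturbation it solves for.\<close>

lemma nondegenerate_if_Lipschitz_localization:
  assumes loc: "Lipschitz_localization (lin_solutions \<theta>) (0, 0) (xbar, \<mu>bar)"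
    and mubar: "\<mu>bar \<in> subdifferential \<theta> (\<Upsilon> (xbar, ubar))"
    and s: "s \<in> S_space \<theta> (\<Upsilon> (xbar, ubar))" "adjx (\<Upsilon>' (xbar, ubar)) s = 0"
  shows "s = 0"
proof -
  let ?A = "subdifferential \<theta> (\<Upsilon> (xbar, ubar))"
  obtain U V f K where U: "open U" "(0, 0) \<in> U" and V: "open V" "(xbar, \<mu>bar) \<in> V"
    and graph: "{(p, y). y \<in> lin_solutions \<theta> p} \<inter> U \<times> V = {(p, f p) | p. p \<in> U}"
    using loc unfolding Lipschitz_localization_def by blast
  have unique: "y = y'" if "p \<in> U" "y \<in> V" "y' \<in> V" "y \<in> lin_solutions \<theta> p" "y' \<in> lin_solutions \<theta> p" for p y y'
  proof -
    have "(p, y) \<in> {(p, f p) | p. p \<in> U}" "(p, y') \<in> {(p, f p) | p. p \<in> U}"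
      unfolding graph[symmetric] using that by auto
    then show ?thesis by auto
  qed
  have "rel_interior ?A \<noteq> {}"
    using rel_interior_eq_empty[OF convex_subdifferential] mubar by blast
  then obtain \<nu> where \<nu>: "\<nu> \<in> rel_interior ?A" by blast
  \<comment> \<open>For \<open>0 < t < 1\<close> these points lie in the relative interior and tend
    to \<open>\<mu>bar\<close> as \<open>t\<close> tends to 0.\<close>
  define \<mu> where "\<mu> t = \<mu>bar - t *\<^sub>R (\<mu>bar - \<nu>)" for t :: real
  \<comment> \<open>The right-hand side for which \<open>(xbar, m)\<close> solves the linearized
    system whenever \<open>m\<close> is a subgradient at the reference value.\<close>
  define p :: "'z \<Rightarrow> 'x \<times> 'z" where "p m = (adjx (\<Upsilon>' (xbar, ubar)) (m - \<mu>bar), 0)" for m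
  have hess0: "hess 0 = 0" by (rule linear_simps[OF bounded_linear_hess])
  have sol: "(xbar, m) \<in> lin_solutions \<theta> (p m)" if "m \<in> ?A" for m
    using that by (simp add: lin_solutions_def p_def hess0 blinfun.zero_right flip: zero_prod_def)
  have lim_\<mu>: "(\<mu> \<longlongrightarrow> \<mu>bar) (at_right 0)"
    unfolding \<mu>_def[abs_def] by (rule tendsto_eq_intros refl | simp)+
  have "((\<lambda>t. p (\<mu> t)) \<longlongrightarrow> (0, 0)) (at_right 0)"
    unfolding p_def
    by (rule tendsto_Pair[OF _ tendsto_const], rule tendsto_eq_rhs,
        rule bounded_linear.tendsto[OF adjx.bounded_linear_right], rule tendsto_diff[OF lim_\<mu> tendsto_const])
       (simp add: adjx.zero_right)
  then have "\<forall>\<^sub>F t in at_right 0. p (\<mu> t) \<in> U" using U by (rule topological_tendstoD)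
  moreover have "\<forall>\<^sub>F t in at_right 0. (xbar, \<mu> t) \<in> V"
    by (rule topological_tendstoD[OF tendsto_Pair[OF tendsto_const lim_\<mu>] V])
  moreover have "\<forall>\<^sub>F t in at_right 0. t \<in> {0<..<1::real}"
    by (rule eventually_at_right_real) simp
  ultimately have "\<forall>\<^sub>F t in at_right 0. p (\<mu> t) \<in> U \<and> (xbar, \<mu> t) \<in> V \<and> t \<in> {0<..<1::real}"
    by (intro eventually_conj)
  then obtain t where t: "p (\<mu> t) \<in> U" "(xbar, \<mu> t) \<in> V" "0 < t" "t < 1"
    using eventually_happens[of _ "at_right (0::real)"] by auto
  have "\<mu> t \<in> rel_interior ?A"
    unfolding \<mu>_def using t by (intro rel_interior_convex_shrink convex_subdifferential \<nu> mubar) auto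
  then obtain e where e: "\<mu> t \<in> ?A" "e > 0" "ball (\<mu> t) e \<inter> affine hull ?A \<subseteq> ?A"
    unfolding mem_rel_interior_ball by blast
  define \<nu>r where "\<nu>r r = \<mu> t + r *\<^sub>R s" for r :: real
  have lim_\<nu>: "(\<nu>r \<longlongrightarrow> \<mu> t) (at_right 0)"
    unfolding \<nu>r_def[abs_def] by (rule tendsto_eq_intros refl | simp)+
  have "\<forall>\<^sub>F r in at_right 0. \<nu>r r \<in> ball (\<mu> t) e"
    using e by (intro topological_tendstoD[OF lim_\<nu>]) auto
  moreover have "\<forall>\<^sub>F r in at_right 0. (xbar, \<nu>r r) \<in> V"
    by (rule topological_tendstoD[OF tendsto_Pair[OF tendsto_const lim_\<nu>] V(1) t(2)])
  moreover have "\<forall>\<^sub>F r in at_right 0. r \<in> {0<..<1::real}"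
    by (rule eventually_at_right_real) simp
  ultimately have "\<forall>\<^sub>F r in at_right 0. \<nu>r r \<in> ball (\<mu> t) e \<and> (xbar, \<nu>r r) \<in> V \<and> r \<in> {0<..<1::real}"
    by (intro eventually_conj)
  then obtain r where r: "\<nu>r r \<in> ball (\<mu> t) e" "(xbar, \<nu>r r) \<in> V" "0 < r"
    using eventually_happens[of _ "at_right (0::real)"] by auto
  have ne: "?A \<noteq> {}" using mubar by blast
  have "\<nu>r r \<in> affine hull ?A"
    unfolding \<nu>r_def using e(1) s(1) subspace_scale[OF subspace_S_space[OF ne]]
    by (intro affine_hull_add_S_space[OF ne] hull_inc) auto
  then have "\<nu>r r \<in> ?A" using e r by blast
  \<comment> \<open>As \<open>s\<close> is in the kernel, both multipliers solve the same linearized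
    system inside \<open>V\<close>; uniqueness and \<open>r > 0\<close> then force
    \<open>s = 0\<close>.\<close>
  moreover have "p (\<nu>r r) = p (\<mu> t)"
    by (simp add: p_def \<nu>r_def adjx.diff_right adjx.add_right adjx.scaleR_right s)
  ultimately have "(xbar, \<nu>r r) = (xbar, \<mu> t)"
    using unique[OF t(1) r(2) t(2)] sol e(1) by metis
  then show ?thesis using r by (simp add: \<nu>r_def)
qed

lemma C2_KKT_I:
  assumes "cpwl \<theta>" "\<Upsilon> (xbar, ubar) \<in> edom \<theta>" and mubar: "\<mu>bar \<in> subdifferential \<theta> (\<Upsilon> (xbar, ubar))"
    and grad: "gradient (\<lambda>x. \<xi> (x, ubar)) xbar + jacobian_adj (\<lambda>x. \<Upsilon> (x, ubar)) xbar \<mu>bar = 0"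
    and nondeg: "S_space \<theta> (\<Upsilon> (xbar, ubar)) \<inter> {\<mu>. jacobian_adj (\<lambda>x. \<Upsilon> (x, ubar)) xbar \<mu> = 0} = {0}"
  shows "C2_KKT \<xi> \<Upsilon> P \<xi>' \<xi>'' \<Upsilon>' \<Upsilon>'' xbar ubar \<mu>bar \<theta> (S_space \<theta> (\<Upsilon> (xbar, ubar)))"
proof unfold_locales
  have ne: "subdifferential \<theta> (\<Upsilon> (xbar, ubar)) \<noteq> {}" using mubar by blast
  show "subspace (S_space \<theta> (\<Upsilon> (xbar, ubar)))" by (rule subspace_S_space[OF ne])
  show "\<mu> - \<mu>bar \<in> S_space \<theta> (\<Upsilon> (xbar, ubar))" if "\<mu> \<in> subdifferential \<theta> (\<Upsilon> (xbar, ubar))" for \<mu>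
    using that mubar by (intro diff_in_S_space[OF ne] hull_inc)
  show "s = 0" if "s \<in> S_space \<theta> (\<Upsilon> (xbar, ubar))" "adjx (\<Upsilon>' (xbar, ubar)) s = 0" for s
    using nondeg that unfolding jacobian_adj_eq[OF ubar] by blast
  show "\<exists>\<delta>>0. \<forall>z \<in> ball (\<Upsilon> (xbar, ubar)) \<delta>. subdifferential \<theta> z \<subseteq> subdifferential \<theta> (\<Upsilon> (xbar, ubar))"
    by (rule cpwl_subdifferential_mono[OF assms(1,2)])
  show "\<mu>bar \<in> subdifferential \<theta> (\<Upsilon> (xbar, ubar))" by (rule mubar)
  show "grad_lagr (xbar, ubar) = 0"
    using grad by (simp only: grad_lagr_def gradient_eq[OF ubar] jacobian_adj_eq[OF ubar])
qed

end

section \<open>Smooth parametrizations\<close>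

lemma C2_on_subset: "C2_on T f \<Longrightarrow> S \<subseteq> T \<Longrightarrow> C2_on S f"
  unfolding C2_on_def by (meson continuous_on_subset has_derivative_subset subsetD)

lemma C2_on_bounded_linear:
  assumes "bounded_linear f" shows "C2_on S f"
  unfolding C2_on_def
proof (intro exI conjI ballI)
  show "(f has_derivative blinfun_apply (Blinfun f)) (at p within S)" for p
    using assms by (simp add: bounded_linear_Blinfun_apply bounded_linear_imp_has_derivative)
  show "((\<lambda>_. Blinfun f) has_derivative blinfun_apply 0) (at p within S)" for p
    by (simp add: zero_blinfun.rep_eq)
qed simp

lemma C2_on_add:
  assumes "C2_on S f" "C2_on S g" shows "C2_on S (\<lambda>p. f p + g p)"
proof -
  obtain f' f'' where f: "\<And>p. p \<in> S \<Longrightarrow> (f has_derivative blinfun_apply (f' p)) (at p within S)"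
    "\<And>p. p \<in> S \<Longrightarrow> (f' has_derivative blinfun_apply (f'' p)) (at p within S)" "continuous_on S f''"
    using assms(1) unfolding C2_on_def by blast
  obtain g' g'' where g: "\<And>p. p \<in> S \<Longrightarrow> (g has_derivative blinfun_apply (g' p)) (at p within S)"
    "\<And>p. p \<in> S \<Longrightarrow> (g' has_derivative blinfun_apply (g'' p)) (at p within S)" "continuous_on S g''"
    using assms(2) unfolding C2_on_def by blast
  have add: "blinfun_apply (a + b) = (\<lambda>d. blinfun_apply a d + blinfun_apply b d)"
    for a b :: "'c::real_normed_vector \<Rightarrow>\<^sub>L 'd::real_normed_vector"
    by (simp add: fun_eq_iff blinfun.add_left)
  show ?thesis unfolding C2_on_def
    by (rule exI[of _ "\<lambda>p. f' p + g' p"], rule exI[of _ "\<lambda>p. f'' p + g'' p"])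
       (auto simp: add intro!: has_derivative_add continuous_on_add f g)
qed

lemma C2_on_sum:
  assumes "\<And>i. i \<in> I \<Longrightarrow> C2_on S (f i)" shows "C2_on S (\<lambda>p. \<Sum>i\<in>I. f i p)"
  using assms
  by (induction I rule: infinite_finite_induct)
     (auto intro: C2_on_add C2_on_bounded_linear bounded_linear_zero)

text \<open>The derivative is itself linear in \<open>p\<close>, so the second derivative is
  constant. The tilt of the objective is a sum of such products.\<close>

lemma C2_on_bounded_linear_mult:
  fixes f g :: "'a::real_normed_vector \<Rightarrow> real"
  assumes "bounded_linear f" "bounded_linear g" shows "C2_on S (\<lambda>p. f p * g p)"
proof -
  define F G where "F = Blinfun f" and "G = Blinfun g"
  have F: "blinfun_apply F = f" and G: "blinfun_apply G = g"
    using assms by (simp_all add: F_def G_def bounded_linear_Blinfun_apply)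
  let ?D = "\<lambda>p. f p *\<^sub>R G + g p *\<^sub>R F"
  have D: "bounded_linear ?D"
    using assms by (intro bounded_linear_add bounded_linear_scaleR_const)
  show ?thesis unfolding C2_on_def
  proof (rule exI[of _ ?D], rule exI[of _ "\<lambda>_. Blinfun ?D"], intro conjI ballI)
    fix p
    show "((\<lambda>p. f p * g p) has_derivative blinfun_apply (?D p)) (at p within S)"
      by (rule has_derivative_eq_rhs, rule has_derivative_mult,
          rule bounded_linear_imp_has_derivative[OF assms(1)], rule bounded_linear_imp_has_derivative[OF assms(2)])
         (simp add: fun_eq_iff blinfun.add_left blinfun.scaleR_left F G)
    show "(?D has_derivative blinfun_apply (Blinfun ?D)) (at p within S)"
      using D by (simp add: bounded_linear_Blinfun_apply bounded_linear_imp_has_derivative)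
  qed simp
qed

text \<open>\<open>R\<close> is precomposition with \<open>T\<close> as a bounded operator on
  derivatives; it puts the second derivative into the form of a composition of operators, whose
  continuity is immediate.\<close>

lemma C2_on_compose_affine:
  fixes f :: "'b::real_normed_vector \<Rightarrow> 'c::real_normed_vector" and T :: "'a::real_normed_vector \<Rightarrow> 'b"
  assumes f: "C2_on UNIV f" and T: "bounded_linear T" shows "C2_on UNIV (\<lambda>p. f (T p + c))"
proof -
  obtain f' f'' where f: "\<And>p. (f has_derivative blinfun_apply (f' p)) (at p)"
    "\<And>p. (f' has_derivative blinfun_apply (f'' p)) (at p)" "continuous_on UNIV f''"
    using f unfolding C2_on_def by auto
  define B where "B = Blinfun T"
  have B: "blinfun_apply B = T" using T by (simp add: B_def bounded_linear_Blinfun_apply)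
  define R :: "('b \<Rightarrow>\<^sub>L 'c) \<Rightarrow>\<^sub>L ('a \<Rightarrow>\<^sub>L 'c)" where "R = Blinfun (\<lambda>l. l o\<^sub>L B)"
  have bR: "bounded_linear (\<lambda>l :: 'b \<Rightarrow>\<^sub>L 'c. l o\<^sub>L B)"
    by (rule bounded_bilinear.bounded_linear_left[OF bounded_bilinear_blinfun_compose])
  have R: "blinfun_apply R = (\<lambda>l. l o\<^sub>L B)" using bR by (simp add: R_def bounded_linear_Blinfun_apply)
  have Td: "((\<lambda>p. T p + c) has_derivative T) (at p)" for p
    by (rule has_derivative_eq_rhs[OF has_derivative_add[OF bounded_linear_imp_has_derivative[OF T] has_derivative_const]]) simp
  show ?thesis unfolding C2_on_def
  proof (rule exI[of _ "\<lambda>p. f' (T p + c) o\<^sub>L B"], rule exI[of _ "\<lambda>p. R o\<^sub>L (f'' (T p + c) o\<^sub>L B)"],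
      intro conjI ballI)
    fix p
    show "((\<lambda>p. f (T p + c)) has_derivative blinfun_apply (f' (T p + c) o\<^sub>L B)) (at p)"
      by (rule has_derivative_eq_rhs[OF has_derivative_compose[OF Td f(1)]]) (simp add: fun_eq_iff B)
    show "((\<lambda>p. f' (T p + c) o\<^sub>L B) has_derivative blinfun_apply (R o\<^sub>L (f'' (T p + c) o\<^sub>L B))) (at p)"
      by (rule has_derivative_eq_rhs[OF bounded_linear.has_derivative[OF bR has_derivative_compose[OF Td f(2)]]])
         (simp add: fun_eq_iff B R)
    have "continuous_on UNIV (\<lambda>p. f'' (T p + c))"
      by (rule continuous_on_compose2[OF f(3)])
         (simp_all add: continuous_on_add linear_continuous_on T)
    then show "continuous_on UNIV (\<lambda>p. R o\<^sub>L (f'' (T p + c) o\<^sub>L B))"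
      by (intro continuous_intros)
  qed
qed

text \<open>Coordinates with respect to an enumeration of the basis, written on unit sequences
  \<open>e i\<close>. This makes the right-hand sides of the linearized system available as
  parameters in some \<open>Rspace q\<close>.\<close>

lemma Rspace_embedding:
  obtains q E \<pi> where "bounded_linear (E :: 'p::euclidean_space \<Rightarrow> nat \<Rightarrow>\<^sub>C real)" "\<And>p. E p \<in> Rspace q"
    "bounded_linear \<pi>" "\<And>p. \<pi> (E p) = p"
proof -
  define q where "q = DIM('p)"
  obtain b where b: "bij_betw b {..<q} (Basis :: 'p set)"
    using ex_bij_betw_nat_finite[of "Basis :: 'p set"] by (auto simp: q_def atLeast0LessThan)
  define e :: "nat \<Rightarrow> nat \<Rightarrow>\<^sub>C real" where "e i = Bcontfun (\<lambda>j. if j = i then 1 else 0)" for i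
  have e: "apply_bcontfun (e i) j = (if j = i then 1 else 0)" for i j
    unfolding e_def by (subst Bcontfun_inverse) (auto intro!: bcontfun_normI[of _ 1])
  define E where "E p = (\<Sum>i<q. (p \<bullet> b i) *\<^sub>R e i)" for p :: 'p
  define \<pi> where "\<pi> u = (\<Sum>i<q. apply_bcontfun u i *\<^sub>R b i)" for u :: "nat \<Rightarrow>\<^sub>C real"
  have lin: "bounded_linear (\<lambda>u :: nat \<Rightarrow>\<^sub>C real. apply_bcontfun u i)" for i
    by (rule bounded_linear_intro[of _ 1]) (use norm_bounded[where 'b = real] in \<open>auto simp: plus_bcontfun.rep_eq scaleR_bcontfun.rep_eq\<close>)
  have E: "apply_bcontfun (E p) j = (if j < q then p \<bullet> b j else 0)" for p j
  proof -
    have "apply_bcontfun (E p) j = (\<Sum>i<q. (p \<bullet> b i) * (if j = i then 1 else 0))"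
      unfolding E_def using linear_sum[OF bounded_linear.linear[OF lin[of j]], of "\<lambda>i. (p \<bullet> b i) *\<^sub>R e i" "{..<q}"]
      by (simp add: scaleR_bcontfun.rep_eq e)
    then show ?thesis by (simp add: if_distrib cong: if_cong)
  qed
  show thesis
  proof (rule that[of E q \<pi>])
    show "bounded_linear E" unfolding E_def[abs_def]
      by (intro bounded_linear_sum bounded_linear_scaleR_const bounded_linear_inner_left)
    show "E p \<in> Rspace q" for p by (simp add: Rspace_def E)
    show "bounded_linear \<pi>" unfolding \<pi>_def[abs_def]
      by (intro bounded_linear_sum bounded_linear_scaleR_const lin)
    show "\<pi> (E p) = p" for p
    proof -
      have "\<pi> (E p) = (\<Sum>i<q. (p \<bullet> b i) *\<^sub>R b i)" by (simp add: \<pi>_def E)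
      also have "\<dots> = (\<Sum>i\<in>Basis. (p \<bullet> i) *\<^sub>R i)" by (rule sum.reindex_bij_betw[OF b])
      finally show ?thesis by (simp add: euclidean_representation)
    qed
  qed
qed

lemma convex_Rspace: "convex (Rspace q)"
  by (rule convexI) (simp add: Rspace_def plus_bcontfun.rep_eq scaleR_bcontfun.rep_eq)

lemma C2_problem_of_parametrization:
  assumes "C2_parametrization \<phi>0 \<Phi> wbar q ubar \<xi> \<Upsilon>" "ubar \<in> Rspace q"
  obtains \<xi>' \<xi>'' \<Upsilon>' \<Upsilon>'' where "C2_problem \<xi> \<Upsilon> (Rspace q) \<xi>' \<xi>'' \<Upsilon>' \<Upsilon>'' ubar"
  using assms convex_Rspace[of q] unfolding C2_parametrization_def C2_on_def C2_problem_def by blast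

text \<open>The parameter, decoded by \<open>\<pi>\<close>, tilts the objective by its first
  component and shifts \<open>\<Phi>\<close> by its second. Smoothness is shown on the whole space
  and then restricted to the subspace.\<close>

lemma C2_parametrization_perturbed:
  fixes \<phi>0 :: "'x::euclidean_space \<times> 'w::real_normed_vector \<Rightarrow> real"
    and \<Phi> :: "'x \<times> 'w \<Rightarrow> 'z::euclidean_space" and \<pi> :: "(nat \<Rightarrow>\<^sub>C real) \<Rightarrow> 'x \<times> 'z"
  assumes \<phi>0: "C2_on UNIV \<phi>0" and \<Phi>: "C2_on UNIV \<Phi>" and \<pi>: "bounded_linear \<pi>"
  shows "C2_parametrization \<phi>0 \<Phi> wbar q 0
     (\<lambda>p. \<phi>0 (fst p, wbar) - fst (\<pi> (snd p)) \<bullet> fst p) (\<lambda>p. \<Phi> (fst p, wbar) + snd (\<pi> (snd p)))"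
proof -
  have T: "bounded_linear (\<lambda>p :: 'x \<times> (nat \<Rightarrow>\<^sub>C real). (fst p, 0 :: 'w))"
    by (intro bounded_linear_Pair bounded_linear_fst bounded_linear_zero)
  have aff: "C2_on UNIV (\<lambda>p :: 'x \<times> (nat \<Rightarrow>\<^sub>C real). f (fst p, wbar))" if "C2_on UNIV f"
    for f :: "'x \<times> 'w \<Rightarrow> 'y::real_normed_vector"
    using C2_on_compose_affine[OF that T, of "(0, wbar)"] by simp
  have \<pi>s: "bounded_linear (\<lambda>p :: 'x \<times> (nat \<Rightarrow>\<^sub>C real). \<pi> (snd p))"
    by (rule bounded_linear_compose[OF \<pi> bounded_linear_snd])
  have "C2_on UNIV (\<lambda>p :: 'x \<times> (nat \<Rightarrow>\<^sub>C real). \<phi>0 (fst p, wbar) + (\<Sum>b\<in>Basis. (- (fst (\<pi> (snd p)) \<bullet> b)) * (fst p \<bullet> b)))"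
    by (intro C2_on_add aff \<phi>0 C2_on_sum C2_on_bounded_linear_mult bounded_linear_minus
        bounded_linear_inner_left_comp bounded_linear_fst
        bounded_linear_compose[OF bounded_linear_fst \<pi>s])
  moreover have "\<phi>0 (fst p, wbar) + (\<Sum>b\<in>Basis. (- (fst (\<pi> (snd p)) \<bullet> b)) * (fst p \<bullet> b)) =
      \<phi>0 (fst p, wbar) - fst (\<pi> (snd p)) \<bullet> fst p" for p
    by (simp add: euclidean_inner[of "fst (\<pi> (snd p))" "fst p"] sum_negf)
  ultimately have "C2_on UNIV (\<lambda>p. \<phi>0 (fst p, wbar) - fst (\<pi> (snd p)) \<bullet> fst p)" by simp
  moreover have "C2_on UNIV (\<lambda>p. \<Phi> (fst p, wbar) + snd (\<pi> (snd p)))"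
    by (intro C2_on_add aff \<Phi> C2_on_bounded_linear bounded_linear_compose[OF bounded_linear_snd \<pi>s])
  ultimately show ?thesis
    unfolding C2_parametrization_def
    by (auto intro: C2_on_subset simp: linear_simps[OF \<pi>])
qed

text \<open>The tilt changes the gradient by \<open>- fst p\<close>, which \<open>residual\<close>
  subtracts, and the shift leaves the Jacobian unchanged. Since \<open>\<xi>'\<close> and
  \<open>\<Upsilon>'\<close> are abstract, both facts rest on uniqueness of the partial
  derivatives.\<close>

lemma (in C2_problem) residual_perturbed:
  assumes u: "u \<in> P" and \<xi>: "\<And>x. \<xi> (x, u) = \<xi> (x, ubar) - fst p \<bullet> x"
    and \<Upsilon>: "\<And>x. \<Upsilon> (x, u) = \<Upsilon> (x, ubar) + snd p"
  shows "residual y u = residual y ubar + p"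
proof -
  have g: "adjx (\<xi>' (x, u)) 1 = adjx (\<xi>' (x, ubar)) 1 - fst p" for x
  proof -
    have "gradient (\<lambda>x. \<xi> (x, u)) x = adjx (\<xi>' (x, ubar)) 1 - fst p"
    proof (rule gradient_eqI, rule has_derivative_eq_rhs)
      show "((\<lambda>x. \<xi> (x, u)) has_derivative (\<lambda>d. \<xi>' (x, ubar) (d, 0) - fst p \<bullet> d)) (at x)"
        unfolding \<xi> using has_derivative_partial[OF \<xi>'[of "(x, ubar)"]] ubar
        by (intro has_derivative_diff has_derivative_inner_right has_derivative_ident) auto
    qed (simp add: fun_eq_iff inner_diff_left inner_adjx)
    then show ?thesis by (simp add: gradient_eq[OF u])
  qed
  have J: "adjx (\<Upsilon>' (x, u)) = adjx (\<Upsilon>' (x, ubar))" for x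
  proof -
    have "((\<lambda>x. \<Upsilon> (x, ubar) + snd p) has_derivative (\<lambda>d. \<Upsilon>' (x, ubar) (d, 0) + 0)) (at x)"
      using has_derivative_partial[OF \<Upsilon>'[of "(x, ubar)"]] ubar
      by (intro has_derivative_add has_derivative_const) auto
    moreover have "((\<lambda>x. \<Upsilon> (x, ubar) + snd p) has_derivative (\<lambda>d. \<Upsilon>' (x, u) (d, 0))) (at x)"
      using has_derivative_partial[OF \<Upsilon>'[of "(x, u)"]] u by (simp add: \<Upsilon>)
    ultimately have "(\<lambda>d. \<Upsilon>' (x, ubar) (d, 0) + 0) = (\<lambda>d. \<Upsilon>' (x, u) (d, 0))"
      by (rule has_derivative_unique)
    then have "\<Upsilon>' (x, ubar) (d, 0) = \<Upsilon>' (x, u) (d, 0)" for d by (simp add: fun_eq_iff)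
    then show ?thesis by (simp add: adjx_def fun_eq_iff)
  qed
  show ?thesis
    by (rule prod_eqI) (simp_all add: residual_def g J \<Upsilon>)
qed

section \<open>The equivalence of stability with ND and strong regularity\<close>

theorem theorem3p4:
  fixes \<theta> :: "real ^ 'm \<Rightarrow> ereal"
    and \<phi>0 :: "(real ^ 'n) \<times> (real ^ 'd) \<Rightarrow> real"
    and \<Phi> :: "(real ^ 'n) \<times> (real ^ 'd) \<Rightarrow> real ^ 'm"
    and xbar :: "real ^ 'n" and wbar :: "real ^ 'd" and zbar \<mu>bar :: "real ^ 'm"
  assumes "cpwl \<theta>"
    and "C2_on UNIV \<phi>0" and "C2_on UNIV \<Phi>"
    and "zbar = \<Phi> (xbar, wbar)" and "zbar \<in> edom \<theta>"
    and "0 \<in> affine hull (subdifferential \<theta> zbar)"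
    and "0 \<in> (\<lambda>\<mu>. gradient (\<lambda>x. \<phi>0 (x, wbar)) xbar + jacobian_adj (\<lambda>x. \<Phi> (x, wbar)) xbar \<mu>)
               ` subdifferential \<theta> zbar"
    and "\<mu>bar \<in> subdifferential \<theta> zbar"
    and "gradient (\<lambda>x. \<phi>0 (x, wbar)) xbar + jacobian_adj (\<lambda>x. \<Phi> (x, wbar)) xbar \<mu>bar = 0"
    and "singular_subdifferential \<theta> zbar \<inter>
           {\<mu>. jacobian_adj (\<lambda>x. \<Phi> (x, wbar)) xbar \<mu> = 0} = {0}"
  shows "(local_minimizer (objective \<phi>0 \<theta> \<Phi> wbar 0) xbar \<and>
          strongly_Lipschitz_stable \<phi>0 \<theta> \<Phi> wbar xbar \<and>
          nondegenerate \<theta> \<Phi> xbar wbar)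
     \<longleftrightarrow> ((\<exists>\<gamma>>0. xbar \<in> M_loc \<phi>0 \<theta> \<Phi> xbar \<gamma> wbar 0) \<and>
          strongly_regular_kkt_solution \<phi>0 \<theta> \<Phi> wbar xbar \<mu>bar)"
proof -
  note zbar = assms(4)
  note mubar = assms(8)[unfolded zbar]
  note grad = assms(9)
  have ND: "nondegenerate \<theta> \<Phi> xbar wbar \<longleftrightarrow>
      S_space \<theta> (\<Phi> (xbar, wbar)) \<inter> {\<mu>. jacobian_adj (\<lambda>x. \<Phi> (x, wbar)) xbar \<mu> = 0} = {0}"
    by (simp add: nondegenerate_def)
  have stat: "stationary \<theta> (\<lambda>x. \<phi>0 (x, wbar)) (\<lambda>x. \<Phi> (x, wbar)) xbar"
    using assms(7) by (simp add: stationary_def zbar)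
  have min: "local_minimizer (objective \<phi>0 \<theta> \<Phi> wbar 0) xbar \<longleftrightarrow>
      (\<exists>\<gamma>>0. xbar \<in> M_loc \<phi>0 \<theta> \<Phi> xbar \<gamma> wbar 0)" (is "?L \<longleftrightarrow> ?R")
  proof
    assume ?L
    then obtain N where N: "open N" "xbar \<in> N" "xbar \<in> argmin_on N (objective \<phi>0 \<theta> \<Phi> wbar 0)"
      unfolding local_minimizer_def by blast
    then obtain \<gamma> where "\<gamma> > 0" "cball xbar \<gamma> \<subseteq> N" using open_contains_cball by blast
    then show ?R using N by (intro exI[of _ \<gamma>]) (auto simp: M_loc_def argmin_on_def)
  next
    assume ?R
    then obtain \<gamma> where "\<gamma> > 0" "xbar \<in> M_loc \<phi>0 \<theta> \<Phi> xbar \<gamma> wbar 0" by blast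
    then show ?L unfolding local_minimizer_def
      by (intro exI[of _ "ball xbar \<gamma>"]) (auto simp: M_loc_def argmin_on_def)
  qed
  \<comment> \<open>The tilt and shift parametrization serves both directions: at parameter 0 it is
    the given problem, so it also expresses the linearized KKT system through
    \<open>P0.lin_solutions\<close>.\<close>
  obtain q and E :: "(real ^ 'n) \<times> (real ^ 'm) \<Rightarrow> nat \<Rightarrow>\<^sub>C real" and \<pi>
    where E: "bounded_linear E" "\<And>p. E p \<in> Rspace q" and \<pi>: "bounded_linear \<pi>" "\<And>p. \<pi> (E p) = p"
    by (rule Rspace_embedding) (rule that; assumption)
  define \<xi>0 where "\<xi>0 = (\<lambda>p :: (real ^ 'n) \<times> (nat \<Rightarrow>\<^sub>C real). \<phi>0 (fst p, wbar) - fst (\<pi> (snd p)) \<bullet> fst p)"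
  define \<Upsilon>0 where "\<Upsilon>0 = (\<lambda>p :: (real ^ 'n) \<times> (nat \<Rightarrow>\<^sub>C real). \<Phi> (fst p, wbar) + snd (\<pi> (snd p)))"
  have param0: "C2_parametrization \<phi>0 \<Phi> wbar q 0 \<xi>0 \<Upsilon>0"
    unfolding \<xi>0_def \<Upsilon>0_def by (rule C2_parametrization_perturbed[OF assms(2,3) \<pi>(1)])
  have zero_R: "0 \<in> Rspace q" by (simp add: Rspace_def zero_bcontfun.rep_eq)
  obtain \<xi>' \<xi>'' \<Upsilon>' \<Upsilon>'' where "C2_problem \<xi>0 \<Upsilon>0 (Rspace q) \<xi>' \<xi>'' \<Upsilon>' \<Upsilon>'' 0"
    using C2_problem_of_parametrization[OF param0 zero_R] by blast
  then interpret P0: C2_problem \<xi>0 \<Upsilon>0 "Rspace q" \<xi>' \<xi>'' \<Upsilon>' \<Upsilon>'' xbar 0 \<mu>bar .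
  have eq0: "\<xi>0 (x, 0) = \<phi>0 (x, wbar)" "\<Upsilon>0 (x, 0) = \<Phi> (x, wbar)" for x
    using param0 unfolding C2_parametrization_def by auto
  have lin0: "linearized_kkt_solutions \<phi>0 \<theta> \<Phi> wbar xbar \<mu>bar = P0.lin_solutions \<theta>"
    by (rule P0.linearized_kkt_solutions_eq) (simp_all add: eq0)
  have kkt: "kkt_solution \<phi>0 \<theta> \<Phi> wbar 0 xbar \<mu>bar"
  proof -
    have "gradient (\<lambda>y. lagrangian \<phi>0 \<Phi> y wbar \<mu>bar) xbar = P0.grad_lagr (xbar, 0)"
      using P0.gradient_lagrangian_eq[OF zero_R, of xbar] by (simp add: lagrangian_def eq0)
    also have "\<dots> = gradient (\<lambda>x. \<xi>0 (x, 0)) xbar + jacobian_adj (\<lambda>x. \<Upsilon>0 (x, 0)) xbar \<mu>bar"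
      by (simp only: P0.grad_lagr_def P0.gradient_eq[OF zero_R] P0.jacobian_adj_eq[OF zero_R])
    also have "\<dots> = 0" using grad by (simp add: eq0)
    finally show ?thesis using mubar by (auto simp: kkt_solution_def subdifferential_inv_def image_iff)
  qed
  have regular: "strongly_regular_kkt_solution \<phi>0 \<theta> \<Phi> wbar xbar \<mu>bar \<longleftrightarrow>
      Lipschitz_localization (P0.lin_solutions \<theta>) (0, 0) (xbar, \<mu>bar)"
    by (simp add: strongly_regular_kkt_solution_def kkt lin0)
  have KKT: "C2_KKT \<xi> \<Upsilon> (Rspace q) \<xi>' \<xi>'' \<Upsilon>' \<Upsilon>'' xbar ubar \<mu>bar \<theta> (S_space \<theta> (\<Upsilon> (xbar, ubar)))"
    if param: "C2_parametrization \<phi>0 \<Phi> wbar q ubar \<xi> \<Upsilon>"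
      and C2: "C2_problem \<xi> \<Upsilon> (Rspace q) \<xi>' \<xi>'' \<Upsilon>' \<Upsilon>'' ubar" and nondeg: "nondegenerate \<theta> \<Phi> xbar wbar"
    for q ubar \<xi> \<Upsilon> \<xi>' \<xi>'' \<Upsilon>' \<Upsilon>''
  proof -
    have eq: "\<xi> (x, ubar) = \<phi>0 (x, wbar)" "\<Upsilon> (x, ubar) = \<Phi> (x, wbar)" for x
      using param unfolding C2_parametrization_def by auto
    show ?thesis
      using assms(1,5) mubar grad nondeg
      by (intro C2_problem.C2_KKT_I[OF C2]) (simp_all add: eq zbar ND)
  qed
  show ?thesis
  proof (intro iffI; elim conjE; intro conjI)
    assume ?L and stable: "strongly_Lipschitz_stable \<phi>0 \<theta> \<Phi> wbar xbar" and nondeg: "nondegenerate \<theta> \<Phi> xbar wbar"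
    then show ?R using min by blast
    interpret C2_KKT \<xi>0 \<Upsilon>0 "Rspace q" \<xi>' \<xi>'' \<Upsilon>' \<Upsilon>'' xbar 0 \<mu>bar \<theta> "S_space \<theta> (\<Upsilon>0 (xbar, 0))"
      by (rule KKT[OF param0 P0.C2_problem_axioms nondeg])
    have "strongly_Lipschitz_stable_wrt \<theta> xbar q 0 \<xi>0 \<Upsilon>0"
      using stable param0 zero_R unfolding strongly_Lipschitz_stable_def by blast
    then obtain U N X U' K where UN: "openin (top_of_set (Rspace q)) U'" "0 \<in> U'" "open N" "xbar \<in> N" "U' \<subseteq> U"
      "K-lipschitz_on U' X"
      and X: "\<And>u. u \<in> U \<Longrightarrow> X u \<in> N \<and> stationary \<theta> (\<lambda>x. \<xi>0 (x, u)) (\<lambda>x. \<Upsilon>0 (x, u)) (X u)"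
      and X_unique: "\<And>u y. u \<in> U \<Longrightarrow> y \<in> N \<Longrightarrow> stationary \<theta> (\<lambda>x. \<xi>0 (x, u)) (\<lambda>x. \<Upsilon>0 (x, u)) y \<Longrightarrow> y = X u"
      unfolding strongly_Lipschitz_stable_wrt_def by metis
    obtain KE where KE: "\<And>p. norm (E p) \<le> norm p * KE" using bounded_linear.bounded[OF E(1)] by blast
    have "Lipschitz_localization (P0.lin_solutions \<theta>) (0, 0) (xbar, \<mu>bar)"
    proof (rule Lipschitz_localization_if_stable[of E KE U' N X K])
      show "E (0, 0) = 0" by (simp add: linear_simps[OF E(1)] flip: zero_prod_def)
      show "dist (E p) (E p') \<le> KE * dist p p'" for p p'
        using KE[of "p - p'"] by (simp add: dist_norm linear_simps[OF E(1)] mult.commute)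
      show "P0.residual y (E p) = P0.residual y 0 + p" for p y
        by (rule P0.residual_perturbed[OF E(2)])
           (simp_all add: \<xi>0_def \<Upsilon>0_def \<pi>(2) linear_simps[OF \<pi>(1)])
    qed (use UN X X_unique E(2) in auto)
    then show "strongly_regular_kkt_solution \<phi>0 \<theta> \<Phi> wbar xbar \<mu>bar" by (simp add: regular)
  next
    assume ?R and reg: "strongly_regular_kkt_solution \<phi>0 \<theta> \<Phi> wbar xbar \<mu>bar"
    then show ?L using min by blast
    have loc: "Lipschitz_localization (P0.lin_solutions \<theta>) (0, 0) (xbar, \<mu>bar)" using reg by (simp add: regular)
    show nondeg: "nondegenerate \<theta> \<Phi> xbar wbar"
    proof -
      have "s = 0" if "s \<in> S_space \<theta> (\<Phi> (xbar, wbar))" "jacobian_adj (\<lambda>x. \<Phi> (x, wbar)) xbar s = 0" for s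
        using P0.nondegenerate_if_Lipschitz_localization[OF loc, of s] that mubar
          P0.jacobian_adj_eq[OF zero_R, of xbar] by (simp add: eq0)
      moreover have "0 \<in> S_space \<theta> (\<Phi> (xbar, wbar))"
        using mubar by (intro subspace_0 subspace_S_space) blast
      moreover have "jacobian_adj (\<lambda>x. \<Phi> (x, wbar)) xbar 0 = 0"
        using P0.jacobian_adj_eq[OF zero_R, of xbar] by (simp add: eq0 adjx.zero_right)
      ultimately show ?thesis unfolding ND by blast
    qed
    show "strongly_Lipschitz_stable \<phi>0 \<theta> \<Phi> wbar xbar"
      unfolding strongly_Lipschitz_stable_def
    proof (intro conjI stat allI ballI impI)
      fix q ubar \<xi> \<Upsilon>
      assume ubar: "ubar \<in> Rspace q" and param: "C2_parametrization \<phi>0 \<Phi> wbar q ubar \<xi> \<Upsilon>"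
      obtain \<xi>' \<xi>'' \<Upsilon>' \<Upsilon>'' where C2: "C2_problem \<xi> \<Upsilon> (Rspace q) \<xi>' \<xi>'' \<Upsilon>' \<Upsilon>'' ubar"
        using C2_problem_of_parametrization[OF param ubar] by blast
      interpret C2_KKT \<xi> \<Upsilon> "Rspace q" \<xi>' \<xi>'' \<Upsilon>' \<Upsilon>'' xbar ubar \<mu>bar \<theta> "S_space \<theta> (\<Upsilon> (xbar, ubar))"
        by (rule KKT[OF param C2 nondeg])
      \<comment> \<open>The linearized system depends only on the data at the reference parameter,
        so the localization obtained for \<open>P0\<close> carries over to every
        parametrization.\<close>
      have "lin_solutions \<theta> = linearized_kkt_solutions \<phi>0 \<theta> \<Phi> wbar xbar \<mu>bar"
        using param by (intro linearized_kkt_solutions_eq[symmetric]) (auto simp: C2_parametrization_def)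
      then have "Lipschitz_localization (lin_solutions \<theta>) (0, 0) (xbar, \<mu>bar)" using loc lin0 by simp
      then show "strongly_Lipschitz_stable_wrt \<theta> xbar q ubar \<xi> \<Upsilon>"
        unfolding strongly_Lipschitz_stable_wrt_def by (rule stable_if_Lipschitz_localization)
    qed
  qed
qed

end
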